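(* For each $x>0$, the limit $\lim_{z\to x,\,z\in\mathbb{C}^+}t(z)=t(x)$ exists (and is finite). Moreover, $1-x(ct(x))^2\ne0$, and the matrix $I+\frac{ct(x)}{1-x(ct(x))^2}R$ is invertible. Therefore $\lim_{z\to x,\,z\in\mathbb{C}^+}T(z)=T(x)$, where $T(x)=\left(-x\left(I+\frac{ct(x)}{1-x(ct(x))^2}R\right)\right)^{-1}$. Moreover, $t(x)$ is a solution of the equation $$t(x)=\frac1M\mathrm{Tr}(RT(x)).$$ If $$u(x)=c\,\frac{|cxt(x)|^2\,\frac1M\mathrm{Tr}(RT(x)T(x)^*R)}{|1-x(ct(x))^2|^2},\qquad v(x)=c\,\frac{\frac1M\mathrm{Tr}(RT(x)T(x)^*R)}{|1-x(ct(x))^2|^2},$$ then $$1-u(x)>0\quad\text{and}\quad(1-u(x))^2-x^2v(x)^2\ge0$$ for each real $x\ne0$. Moreover, the last inequality is strict if $x\in\mathbb{R}^+\setminus\mathcal{S}$. If moreover $\mathrm{Im}(t(x))>0$, then $$1-u(x)-xv(x)=0 .$$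
   Context: $M,N,L\ge1$ are integers, $c=ML/N$, and $R$ is an $M\times M$ Hermitian matrix with $aI_M\le R<bI_M$, $0<a<b$. $\mathbb{C}^+$ is the open upper half plane and $\mathbb{R}^+=[0,\infty)$. For $z\in\mathbb{C}^+$, $t(z)$ is the unique solution with $t(z)\in\mathbb{C}^+$, $zt(z)\in\mathbb{C}^+$ of $t(z)=\frac1M\mathrm{Tr}\,R\left(-zI_M-\frac{zct(z)}{1-zc^2t(z)^2}R\right)^{-1}$, and $T(z)=-\left(zI_M+\frac{zct(z)}{1-zc^2t(z)^2}R\right)^{-1}$. $t$ is the Stieltjes transform $\int\frac{d\mu(\lambda)}{\lambda-z}$ of a positive finite measure $\mu$ carried by $\mathbb{R}^+$, with support $\mathcal{S}$; $t$ and $T$ extend analytically to $\mathbb{C}\setminus\mathcal{S}$, and for $x<0$ the symbols $t(x)$, $T(x)$ denote the values of these extensions. *)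

theory Defs
  imports "HOL-Complex_Analysis.Complex_Analysis"
begin

definition conj_transpose :: "complex^'n^'m \<Rightarrow> complex^'m^'n" where
  "conj_transpose A = (\<chi> i j. cnj (A $ j $ i))"

definition hermitian :: "complex^'n^'n \<Rightarrow> bool" where
  "hermitian A \<longleftrightarrow> conj_transpose A = A"

text \<open>The value \<open>x\<^sup>* A x\<close>; it is real when \<open>A\<close> is Hermitian.\<close>

definition quad_form :: "complex^'n^'n \<Rightarrow> complex^'n \<Rightarrow> complex" where
  "quad_form A x = (\<Sum>i\<in>UNIV. cnj (x $ i) * (A *v x) $ i)"

definition pos_semidef :: "complex^'n^'n \<Rightarrow> bool" where
  "pos_semidef A \<longleftrightarrow> hermitian A \<and> (\<forall>x. 0 \<le> Re (quad_form A x))"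

definition pos_def :: "complex^'n^'n \<Rightarrow> bool" where
  "pos_def A \<longleftrightarrow> hermitian A \<and> (\<forall>x. x \<noteq> 0 \<longrightarrow> 0 < Re (quad_form A x))"

definition ntrace :: "complex^'n^'n \<Rightarrow> complex" where
  "ntrace A = trace A / of_nat CARD('n)"

definition measure_support :: "'a::topological_space measure \<Rightarrow> 'a set" where
  "measure_support \<mu> = {x. \<forall>U. open U \<and> x \<in> U \<longrightarrow> emeasure \<mu> U > 0}"

definition stieltjes :: "real measure \<Rightarrow> complex \<Rightarrow> complex" where
  "stieltjes \<mu> z = (LINT l|\<mu>. 1 / (complex_of_real l - z))"

definition upper_half_plane :: "complex set" where
  "upper_half_plane = {z. Im z > 0}"

text \<open>
  Throughout, \<open>mat k ** A\<close> is the scalar multiple \<open>k A\<close> for complex \<open>k\<close>.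

  In \<open>canonical_solution\<close> no division by zero or inverse of a singular matrix can
  interfere when \<open>R\<close> is Hermitian and \<open>z\<close> is in the upper half plane: \<open>s\<close> and \<open>z s\<close>
  having positive imaginary part, the product \<open>s (z s)\<close> is not a positive real, and
  \<open>z + z c s r / (1 - z c\<^sup>2 s\<^sup>2) = 0\<close> with \<open>r\<close> real would give
  \<open>1 / s + c r - c\<^sup>2 z s = 0\<close>, whose left-hand side has negative imaginary part.
\<close>

definition canonical_solution ::
    "real \<Rightarrow> complex^'m^'m \<Rightarrow> complex \<Rightarrow> complex \<Rightarrow> bool" where
  "canonical_solution c R z s \<longleftrightarrow>
     s \<in> upper_half_plane \<and> z * s \<in> upper_half_plane \<and>
     s = ntrace (R ** matrix_inv
           (- mat z - mat (z * of_real c * s / (1 - z * (of_real c)\<^sup>2 * s\<^sup>2)) ** R))"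

definition T_matrix ::
    "real \<Rightarrow> complex^'m^'m \<Rightarrow> complex \<Rightarrow> complex \<Rightarrow> complex^'m^'m" where
  "T_matrix c R z s =
     - matrix_inv (mat z + mat (z * of_real c * s / (1 - z * (of_real c)\<^sup>2 * s\<^sup>2)) ** R)"

text \<open>
  Values on the real axis: for \<open>x > 0\<close> the limit from the upper half plane (meaningful
  only once that limit is known to exist), otherwise the value of \<open>f\<close> itself.
\<close>

definition real_axis_value :: "(complex \<Rightarrow> 'b::t2_space) \<Rightarrow> real \<Rightarrow> 'b" where
  "real_axis_value f x =
     (if x > 0 then Lim (at (of_real x) within upper_half_plane) f else f (of_real x))"

text \<open>
  Here \<open>\<tau>\<close> and \<open>\<Theta>\<close> stand for \<open>t(x)\<close> and \<open>T(x)\<close>. The trace of \<open>R \<Theta> \<Theta>\<^sup>* R\<close> is real for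
  Hermitian \<open>R\<close>.
\<close>

definition v_coeff ::
    "real \<Rightarrow> complex^'m^'m \<Rightarrow> real \<Rightarrow> complex \<Rightarrow> complex^'m^'m \<Rightarrow> real" where
  "v_coeff c R x \<tau> \<Theta> =
     c * (Re (ntrace (R ** \<Theta> ** conj_transpose \<Theta> ** R))
          / (cmod (1 - of_real x * (of_real c * \<tau>)\<^sup>2))\<^sup>2)"

definition u_coeff ::
    "real \<Rightarrow> complex^'m^'m \<Rightarrow> real \<Rightarrow> complex \<Rightarrow> complex^'m^'m \<Rightarrow> real" where
  "u_coeff c R x \<tau> \<Theta> =
     c * ((cmod (of_real c * of_real x * \<tau>))\<^sup>2
          * Re (ntrace (R ** \<Theta> ** conj_transpose \<Theta> ** R))
          / (cmod (1 - of_real x * (of_real c * \<tau>)\<^sup>2))\<^sup>2)"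

end

theory Submission
  imports Defs
begin

text \<open>
  Write \<open>d = 1 - z c\<^sup>2 s\<^sup>2\<close> and \<open>A = z + (z c s / d) R\<close>, where \<open>s = t(z)\<close>. Then
  \<open>\<Theta> = T(z)\<close> satisfies \<open>A \<Theta> = -1\<close> and \<open>s = (1/M) Tr (R \<Theta>)\<close>. Everything is read off
  from one identity. Multiplying \<open>R \<Theta>\<close> by \<open>- \<Theta>\<^sup>* A\<^sup>* = 1\<close> and taking the normalised trace
  gives (\<open>trace_identity\<close>)

  \<open>s = - z\<^sup>* q - (z c s / d)\<^sup>* W\<close>, with \<open>q = (1/M) Tr (R \<Theta> \<Theta>\<^sup>*) > 0\<close> and
  \<open>W = (1/M) Tr (R \<Theta> \<Theta>\<^sup>* R) > 0\<close>.

  The imaginary parts of \<open>s\<close> and of \<open>z s\<close> then satisfy the linear system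
  \<open>(1 - u) Im s - v Im (z s) = q Im z\<close> and \<open>(1 - u) Im (z s) = |z|\<^sup>2 v Im s\<close>. In the upper
  half plane all quantities except \<open>1 - u\<close> are known to be positive, which forces
  \<open>u + |z| v < 1\<close> (\<open>weights_upper_half_plane\<close>).

  This inequality carries the boundary analysis. It reads
  \<open>c (|c z s|\<^sup>2 + |z|) W \<le> |d|\<^sup>2\<close>, a closed condition. At a limit point over \<open>x \<noteq> 0\<close> it
  excludes \<open>d = 0\<close>: otherwise \<open>W = 0\<close>, hence \<open>s = 0\<close> by Cauchy--Schwarz, hence \<open>d = 1\<close>.
  So every finite limit of \<open>(t, T)\<close> over \<open>x \<noteq> 0\<close> solves the same
  equations and satisfies \<open>u + |x| v \<le> 1\<close> (\<open>resolvent_pair_tendsto\<close>).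

  For \<open>x > 0\<close> two limits must agree (\<open>boundary_pair_unique\<close>). The resolvent identity expresses
  \<open>s\<^sub>1 - s\<^sub>2\<close> as \<open>s\<^sub>1 - s\<^sub>2\<close> times a factor that Cauchy--Schwarz and the inequality bound by
  \<open>1\<close>, with equality only for \<open>s\<^sub>1 = s\<^sub>2\<^sup>*\<close>; as both imaginary parts are nonnegative, this
  is \<open>s\<^sub>1 = s\<^sub>2\<close>. Since \<open>t\<close> and \<open>T\<close> remain bounded near \<open>x\<close>
  (\<open>resolvent_pair_bounded\<close>), compactness turns uniqueness of the limit point into convergence.
  For \<open>x < 0\<close> the limits exist because \<open>t\<close> and \<open>T\<close> are analytic there.

  At a real \<open>x \<noteq> 0\<close> the two inequalities are \<open>u + |x| v \<le> 1\<close> together with \<open>v > 0\<close>, and the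
  final equation is the first line of the linear system with \<open>Im z = 0\<close>, divided by
  \<open>Im t(x)\<close>. For strictness off the support, the system gives
  \<open>((1 - u)\<^sup>2 - |z|\<^sup>2 v\<^sup>2) Im s = (1 - u) q Im z\<close>, and off the support the Stieltjes integral
  shows \<open>Im t(z) \<le> C Im z\<close>; dividing by \<open>Im z\<close> bounds the left factor away from zero in the limit.
\<close>

section \<open>Complex matrices with the Frobenius norm\<close>

(* Leaves \<open>$\<close> to the components of vectors only. *)
no_notation fps_nth (infixl "$" 75)

lemma mat_mult_nth: "(mat k ** A) $ i $ j = k * (A $ i $ j)"
proof -
  have "(mat k ** A) $ i $ j = (\<Sum>l\<in>UNIV. if i = l then k * (A $ l $ j) else 0)"
    by (simp add: matrix_matrix_mult_def mat_def if_distrib[of "\<lambda>x. x * _"] cong: if_cong)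
  then show ?thesis by simp
qed

lemma mult_mat_nth: "(A ** mat k) $ i $ j = (A $ i $ j) * k"
proof -
  have "(A ** mat k) $ i $ j = (\<Sum>l\<in>UNIV. if l = j then (A $ i $ l) * k else 0)"
    by (simp add: matrix_matrix_mult_def mat_def if_distrib[of "\<lambda>x. _ * x"] cong: if_cong)
  then show ?thesis by simp
qed

lemma mult_mat_eq_mat_mult: "A ** mat k = mat k ** (A :: 'a::comm_semiring_1^'n^'m)"
  by (simp add: vec_eq_iff mat_mult_nth mult_mat_nth mult.commute)

lemma matrix_add_rdistrib: "(A + B) ** C = A ** C + B ** (C :: 'a::comm_ring_1^'p^'n)"
  by (simp add: vec_eq_iff matrix_matrix_mult_def distrib_right sum.distrib)

lemma matrix_diff_ldistrib: "A ** (B - C) = A ** B - A ** (C :: 'a::comm_ring_1^'p^'n)"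
  by (simp add: vec_eq_iff matrix_matrix_mult_def right_diff_distrib sum_subtractf)

lemma matrix_diff_rdistrib: "(A - B) ** C = A ** C - B ** (C :: 'a::comm_ring_1^'p^'n)"
  by (simp add: vec_eq_iff matrix_matrix_mult_def left_diff_distrib sum_subtractf)

lemma matrix_mult_minus_right: "A ** (- B) = - (A ** (B :: 'a::comm_ring_1^'p^'n))"
  by (simp add: vec_eq_iff matrix_matrix_mult_def sum_negf)

lemma matrix_mult_minus_left: "(- A) ** B = - (A ** (B :: 'a::comm_ring_1^'p^'n))"
  by (simp add: vec_eq_iff matrix_matrix_mult_def sum_negf)

lemma trace_mat_mult: "trace (mat k ** A) = k * trace (A :: 'a::comm_semiring_1^'n^'n)"
  by (simp add: trace_def mat_mult_nth sum_distrib_left)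

lemma ntrace_mat_mult: "ntrace (mat k ** A) = k * ntrace A"
  by (simp add: ntrace_def trace_mat_mult)

lemma ntrace_add: "ntrace (A + B) = ntrace A + ntrace B"
  by (simp add: ntrace_def trace_add add_divide_distrib)

lemma ntrace_diff: "ntrace (A - B) = ntrace A - ntrace B"
  by (simp add: ntrace_def trace_sub diff_divide_distrib)

lemma conj_transpose_mult:
  "conj_transpose (A ** B) = conj_transpose B ** conj_transpose A"
  by (simp add: vec_eq_iff conj_transpose_def matrix_matrix_mult_def mult.commute)

lemma conj_transpose_add: "conj_transpose (A + B) = conj_transpose A + conj_transpose B"
  by (simp add: vec_eq_iff conj_transpose_def)

lemma conj_transpose_mat: "conj_transpose (mat k) = mat (cnj k)"
  by (auto simp: vec_eq_iff conj_transpose_def mat_def)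

text \<open>
The norm of the type \<open>complex^'n^'m\<close> is the Frobenius norm, so \<open>Tr (A A\<^sup>*)\<close> is its square
and Cauchy--Schwarz for traces is Cauchy--Schwarz for the entries.
\<close>

lemma norm_matrix_power2:
  "(norm (A :: complex^'n^'m))\<^sup>2 = (\<Sum>i\<in>UNIV. \<Sum>j\<in>UNIV. (cmod (A $ i $ j))\<^sup>2)"
  by (simp add: norm_vec_def L2_set_def sum_nonneg)

lemma trace_mult_conj_transpose:
  "trace (A ** conj_transpose A) = complex_of_real ((norm (A :: complex^'n^'m))\<^sup>2)"
  unfolding norm_matrix_power2
  by (simp add: trace_def matrix_matrix_mult_def conj_transpose_def complex_norm_square
      del: of_real_power)

lemma norm_conj_transpose: "norm (conj_transpose A) = norm A"
proof -
  have "(norm (conj_transpose A))\<^sup>2 = (norm A)\<^sup>2"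
    unfolding norm_matrix_power2 conj_transpose_def by (simp, rule sum.swap)
  then show ?thesis by simp
qed

lemma norm_mat_mult: "norm (mat k ** (A :: complex^'n^'m)) = cmod k * norm A"
proof -
  have "(norm (mat k ** A))\<^sup>2 = (cmod k * norm A)\<^sup>2"
    unfolding power_mult_distrib
    unfolding norm_matrix_power2 mat_mult_nth
    by (simp add: norm_mult power_mult_distrib sum_distrib_left)
  then show ?thesis by simp
qed

lemma Cauchy_Schwarz_complex_sum:
  fixes f g :: "'i \<Rightarrow> complex"
  shows "(cmod (\<Sum>i\<in>I. f i * g i))\<^sup>2 \<le> (\<Sum>i\<in>I. (cmod (f i))\<^sup>2) * (\<Sum>i\<in>I. (cmod (g i))\<^sup>2)"
proof -
  have "cmod (\<Sum>i\<in>I. f i * g i) \<le> (\<Sum>i\<in>I. \<bar>cmod (f i)\<bar> * \<bar>cmod (g i)\<bar>)"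
    by (rule order_trans[OF norm_sum]) (simp add: norm_mult)
  also have "\<dots> \<le> L2_set (\<lambda>i. cmod (f i)) I * L2_set (\<lambda>i. cmod (g i)) I"
    by (rule L2_set_mult_ineq)
  finally have "(cmod (\<Sum>i\<in>I. f i * g i))\<^sup>2 \<le> (L2_set (\<lambda>i. cmod (f i)) I * L2_set (\<lambda>i. cmod (g i)) I)\<^sup>2"
    by (intro power_mono) auto
  then show ?thesis
    by (simp add: power_mult_distrib L2_set_def sum_nonneg)
qed

lemma norm_matrix_mult_le: "norm (A ** B) \<le> norm A * norm (B :: complex^'p^'n)"
proof -
  have "(norm (A ** B))\<^sup>2 \<le> (\<Sum>i\<in>UNIV. \<Sum>j\<in>UNIV.
      (\<Sum>k\<in>UNIV. (cmod (A $ i $ k))\<^sup>2) * (\<Sum>k\<in>UNIV. (cmod (B $ k $ j))\<^sup>2))"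
    unfolding norm_matrix_power2 matrix_matrix_mult_def
    by (intro sum_mono) (simp add: Cauchy_Schwarz_complex_sum)
  also have "\<dots> = (\<Sum>i\<in>UNIV. \<Sum>k\<in>UNIV. (cmod (A $ i $ k))\<^sup>2) *
      (\<Sum>j\<in>UNIV. \<Sum>k\<in>UNIV. (cmod (B $ k $ j))\<^sup>2)"
    by (simp add: sum_product)
  also have "\<dots> = (norm A * norm B)\<^sup>2"
    unfolding power_mult_distrib norm_matrix_power2 by (subst (4) sum.swap) simp
  finally show ?thesis
    by (rule power2_le_imp_le) simp
qed

lemma norm_trace_mult_le: "cmod (trace (A ** B)) \<le> norm A * norm (B :: complex^'m^'n)"
proof -
  define f where "f = (\<lambda>(i, j). A $ i $ j)"
  define g where "g = (\<lambda>(i, j). B $ j $ i)"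
  have "trace (A ** B) = (\<Sum>p\<in>UNIV \<times> UNIV. f p * g p)"
    unfolding sum.cartesian_product' by (simp add: trace_def matrix_matrix_mult_def f_def g_def)
  then have "(cmod (trace (A ** B)))\<^sup>2 \<le>
      (\<Sum>p\<in>UNIV \<times> UNIV. (cmod (f p))\<^sup>2) * (\<Sum>p\<in>UNIV \<times> UNIV. (cmod (g p))\<^sup>2)"
    by (simp only: Cauchy_Schwarz_complex_sum)
  also have "\<dots> = (norm A * norm (conj_transpose B))\<^sup>2"
    unfolding power_mult_distrib norm_matrix_power2 conj_transpose_def sum.cartesian_product'
    by (simp add: f_def g_def)
  finally have "(cmod (trace (A ** B)))\<^sup>2 \<le> (norm A * norm B)\<^sup>2"
    by (simp only: norm_conj_transpose)
  then show ?thesis by (rule power2_le_imp_le) simp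
qed

lemma norm_ntrace_power2_le:
  "(cmod (ntrace (A :: complex^'m^'m)))\<^sup>2 \<le> (norm A)\<^sup>2 / real CARD('m)"
proof -
  have "complex_of_real ((norm (mat 1 :: complex^'m^'m))\<^sup>2) = complex_of_real (real CARD('m))"
    unfolding trace_mult_conj_transpose[symmetric] by (simp add: conj_transpose_mat trace_I)
  then have "(norm (mat 1 :: complex^'m^'m))\<^sup>2 = real CARD('m)"
    by (simp only: of_real_eq_iff)
  moreover have "(cmod (trace A))\<^sup>2 \<le> (norm A * norm (mat 1 :: complex^'m^'m))\<^sup>2"
    using norm_trace_mult_le[of A "mat 1"] by (intro power_mono) auto
  ultimately have "(cmod (trace A))\<^sup>2 \<le> (norm A)\<^sup>2 * real CARD('m)"
    by (simp add: power_mult_distrib)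
  then show ?thesis
    by (simp add: ntrace_def norm_divide power_divide field_simps power2_eq_square)
qed

lemma matrix_inv_eqI:
  fixes A :: "'a::field^'n^'n"
  assumes "A ** B = mat 1"
  shows "matrix_inv A = B"
proof -
  have "B ** A = mat 1" using assms by (simp add: matrix_left_right_inverse)
  with assms have "A ** matrix_inv A = mat 1 \<and> matrix_inv A ** A = mat 1"
    unfolding matrix_inv_def by (intro someI[of "\<lambda>X. A ** X = mat 1 \<and> X ** A = mat 1"]) simp
  then show ?thesis
    by (metis \<open>B ** A = mat 1\<close> matrix_mul_assoc matrix_mul_lid matrix_mul_rid)
qed

lemma tendsto_matrix_mult [tendsto_intros]:
  fixes f :: "'x \<Rightarrow> complex^'n^'m" and g :: "'x \<Rightarrow> complex^'p^'n"
  assumes "(f \<longlongrightarrow> A) F" and "(g \<longlongrightarrow> B) F"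
  shows "((\<lambda>x. f x ** g x) \<longlongrightarrow> A ** B) F"
  unfolding matrix_matrix_mult_def
  by (intro tendsto_vec_lambda tendsto_sum tendsto_mult tendsto_vec_nth assms)

lemma tendsto_mat [tendsto_intros]:
  fixes f :: "'x \<Rightarrow> complex"
  assumes "(f \<longlongrightarrow> k) F"
  shows "((\<lambda>x. mat (f x)) \<longlongrightarrow> (mat k :: complex^'n^'n)) F"
  unfolding mat_def
  by (intro tendsto_vec_lambda) (use assms in auto)

lemma tendsto_conj_transpose [tendsto_intros]:
  assumes "(f \<longlongrightarrow> A) F"
  shows "((\<lambda>x. conj_transpose (f x)) \<longlongrightarrow> conj_transpose A) F"
  unfolding conj_transpose_def
  by (intro tendsto_vec_lambda tendsto_cnj tendsto_vec_nth assms)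

lemma tendsto_ntrace [tendsto_intros]:
  assumes "(f \<longlongrightarrow> A) F"
  shows "((\<lambda>x. ntrace (f x)) \<longlongrightarrow> ntrace A) F"
  unfolding ntrace_def trace_def
  by (intro tendsto_divide tendsto_sum tendsto_vec_nth assms tendsto_const) simp

lemma Im_quad_form_hermitian:
  assumes "hermitian A"
  shows "Im (quad_form A x) = 0"
proof -
  have "cnj (A $ i $ j) = A $ j $ i" for i j
    using assms by (simp add: hermitian_def conj_transpose_def vec_eq_iff)
  then have "cnj (quad_form A x) = (\<Sum>i\<in>UNIV. \<Sum>j\<in>UNIV. cnj (x $ j) * (A $ j $ i * x $ i))"
    by (simp add: quad_form_def matrix_vector_mult_def sum_distrib_left mult_ac)
  also have "\<dots> = quad_form A x"
    by (subst sum.swap) (simp add: quad_form_def matrix_vector_mult_def sum_distrib_left)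
  finally show ?thesis by (simp add: complex_eq_iff)
qed

lemma mat_mult_vector: "mat k *v x = k *s (x :: complex^'n)"
proof -
  have "(mat k *v x) $ i = (\<Sum>l\<in>UNIV. if i = l then k * x $ l else 0)" for i
    by (simp add: matrix_vector_mult_def mat_def if_distrib[of "\<lambda>x. x * _"] cong: if_cong)
  then show ?thesis by (simp add: vec_eq_iff)
qed

lemma quad_form_add: "quad_form (A + B) x = quad_form A x + quad_form B x"
  by (simp add: quad_form_def matrix_vector_mult_add_rdistrib distrib_left sum.distrib)

lemma quad_form_diff: "quad_form (A - B) x = quad_form A x - quad_form B x"
  by (simp add: quad_form_def matrix_vector_mult_diff_rdistrib right_diff_distrib sum_subtractf)

lemma quad_form_mat_mult: "quad_form (mat k ** A) x = k * quad_form A x"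
  by (simp add: quad_form_def matrix_vector_mul_assoc[symmetric] mat_mult_vector
      sum_distrib_left mult_ac)

lemma quad_form_mat: "quad_form (mat k) x = k * of_real ((norm x)\<^sup>2)"
proof -
  have "(norm x)\<^sup>2 = (\<Sum>i\<in>UNIV. (cmod (x $ i))\<^sup>2)"
    by (simp add: norm_vec_def L2_set_def sum_nonneg)
  then show ?thesis
    by (simp add: quad_form_def mat_mult_vector sum_distrib_left complex_norm_square mult_ac
        del: of_real_power)
qed

text \<open>
This turns positivity of the quadratic form of \<open>A\<close> into positivity of \<open>Tr (A B B\<^sup>*)\<close>.
\<close>

lemma trace_congruence:
  "trace (conj_transpose B ** A ** B) = (\<Sum>j\<in>UNIV. quad_form A (column j B))"
proof -
  have "trace (conj_transpose B ** (A ** B)) = (\<Sum>j\<in>UNIV. \<Sum>i\<in>UNIV. cnj (B $ i $ j) * (A ** B) $ i $ j)"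
    by (simp add: trace_def matrix_matrix_mult_def conj_transpose_def)
  also have "\<dots> = (\<Sum>j\<in>UNIV. quad_form A (column j B))"
    by (simp add: quad_form_def column_def matrix_vector_mult_def matrix_matrix_mult_def)
  finally show ?thesis by (simp add: matrix_mul_assoc)
qed

section \<open>Solutions of the trace equation\<close>

definition denom :: "real \<Rightarrow> complex \<Rightarrow> complex \<Rightarrow> complex" where
  "denom c z s = 1 - z * (of_real c)\<^sup>2 * s\<^sup>2"

text \<open>
For Hermitian \<open>R\<close> this is \<open>(1/M) Tr (R \<Theta> \<Theta>\<^sup>* R)\<close>; the norm makes its nonnegativity and the
Cauchy--Schwarz bounds immediate.
\<close>

definition mean_energy :: "complex^'m^'m \<Rightarrow> complex^'m^'m \<Rightarrow> real" where
  "mean_energy R \<Theta> = (norm (R ** \<Theta>))\<^sup>2 / real CARD('m)"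

definition mean_mass :: "complex^'m^'m \<Rightarrow> complex^'m^'m \<Rightarrow> real" where
  "mean_mass R \<Theta> = Re (ntrace (R ** \<Theta> ** conj_transpose \<Theta>))"

text \<open>
The coefficients \<open>u\<close> and \<open>v\<close> at a complex point, so that they can be followed from the upper half
plane to the real axis.
\<close>

definition u_weight :: "real \<Rightarrow> complex^'m^'m \<Rightarrow> complex \<Rightarrow> complex \<Rightarrow> complex^'m^'m \<Rightarrow> real" where
  "u_weight c R z s \<Theta> =
     c * (cmod (of_real c * z * s))\<^sup>2 * mean_energy R \<Theta> / (cmod (denom c z s))\<^sup>2"

definition v_weight :: "real \<Rightarrow> complex^'m^'m \<Rightarrow> complex \<Rightarrow> complex \<Rightarrow> complex^'m^'m \<Rightarrow> real" where
  "v_weight c R z s \<Theta> = c * mean_energy R \<Theta> / (cmod (denom c z s))\<^sup>2"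

text \<open>
The trace equation with the inverse matrix as an unknown of its own. In this form it is
meaningful on the real axis as well, and passes to limits as long as \<open>denom\<close> does not vanish.
\<close>

definition resolvent_pair ::
    "real \<Rightarrow> complex^'m^'m \<Rightarrow> complex \<Rightarrow> complex \<Rightarrow> complex^'m^'m \<Rightarrow> bool" where
  "resolvent_pair c R z s \<Theta> \<longleftrightarrow> denom c z s \<noteq> 0 \<and>
     (mat z + mat (z * (of_real c * s / denom c z s)) ** R) ** \<Theta> = - mat 1 \<and>
     s = ntrace (R ** \<Theta>)"

lemma resolvent_pairD:
  assumes "resolvent_pair c R z s \<Theta>"
  shows "denom c z s \<noteq> 0"
    and "(mat z + mat (z * (of_real c * s / denom c z s)) ** R) ** \<Theta> = - mat 1"
    and "s = ntrace (R ** \<Theta>)"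
  using assms unfolding resolvent_pair_def by blast+

lemma mean_energy_eq:
  assumes "hermitian R"
  shows "Re (ntrace (R ** \<Theta> ** conj_transpose \<Theta> ** R)) = mean_energy R \<Theta>"
    and "ntrace (R ** \<Theta> ** conj_transpose \<Theta> ** R) = of_real (mean_energy R \<Theta>)"
proof -
  have "R ** \<Theta> ** conj_transpose \<Theta> ** R = (R ** \<Theta>) ** conj_transpose (R ** \<Theta>)"
    using assms by (simp add: conj_transpose_mult hermitian_def matrix_mul_assoc)
  then show *: "ntrace (R ** \<Theta> ** conj_transpose \<Theta> ** R) = of_real (mean_energy R \<Theta>)"
    unfolding ntrace_def mean_energy_def by (simp only: trace_mult_conj_transpose) simp
  show "Re (ntrace (R ** \<Theta> ** conj_transpose \<Theta> ** R)) = mean_energy R \<Theta>"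
    unfolding * by simp
qed

lemma mean_energy_nonneg: "0 \<le> mean_energy R \<Theta>"
  by (simp add: mean_energy_def)

lemma u_coeff_eq_u_weight:
  "hermitian R \<Longrightarrow> u_coeff c R x \<tau> \<Theta> = u_weight c R (of_real x) \<tau> \<Theta>"
  by (simp add: u_coeff_def u_weight_def mean_energy_eq denom_def power_mult_distrib mult_ac)

lemma v_coeff_eq_v_weight:
  "hermitian R \<Longrightarrow> v_coeff c R x \<tau> \<Theta> = v_weight c R (of_real x) \<tau> \<Theta>"
  by (simp add: v_coeff_def v_weight_def mean_energy_eq denom_def power_mult_distrib mult_ac)

lemma cmod_ntrace_power2_le_mean_energy: "(cmod (ntrace (R ** \<Theta>)))\<^sup>2 \<le> mean_energy R \<Theta>"
  unfolding mean_energy_def by (rule norm_ntrace_power2_le)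

text \<open>
The right-hand side is polynomial in the norms, hence a closed condition that makes sense even
where \<open>denom\<close> vanishes.
\<close>

lemma weights_le_iff:
  assumes "denom c z s \<noteq> 0"
  shows "u_weight c R z s \<Theta> + cmod z * v_weight c R z s \<Theta> \<le> 1 \<longleftrightarrow>
    c * ((cmod (of_real c * z * s))\<^sup>2 + cmod z) * mean_energy R \<Theta> \<le> (cmod (denom c z s))\<^sup>2"
proof -
  have "u_weight c R z s \<Theta> + cmod z * v_weight c R z s \<Theta> =
     c * ((cmod (of_real c * z * s))\<^sup>2 + cmod z) * mean_energy R \<Theta> / (cmod (denom c z s))\<^sup>2"
    by (simp add: u_weight_def v_weight_def add_divide_distrib algebra_simps)
  then show ?thesis using assms by simp
qed

text \<open>
Both follow from \<open>w / d = w d\<^sup>* / |d|\<^sup>2\<close> by multiplying out \<open>d\<^sup>* = 1 - z\<^sup>* c\<^sup>2 (s\<^sup>*)\<^sup>2\<close>; the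
cubic terms collapse to \<open>|z s|\<^sup>2 s\<^sup>*\<close> and \<open>|s|\<^sup>2 (z s)\<^sup>*\<close>.
\<close>

lemma Im_coupling:
  fixes c :: real
  shows "Im (z * (of_real c * s) / denom c z s) =
      (c * Im (z * s) + c^3 * (cmod (z * s))\<^sup>2 * Im s) / (cmod (denom c z s))\<^sup>2"
    and "Im (of_real c * s / denom c z s) =
      (c * Im s + c^3 * (cmod s)\<^sup>2 * Im (z * s)) / (cmod (denom c z s))\<^sup>2"
proof -
  define d where "d = denom c z s"
  have cnj_d: "cnj d = 1 - cnj z * (of_real c)\<^sup>2 * (cnj s)\<^sup>2"
    by (simp add: d_def denom_def)
  have quot: "Im (w / d) = Im (w * cnj d) / (cmod d)\<^sup>2" for w
    by (subst complex_div_cnj) (simp flip: of_real_power)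
  have Im_combination: "Im (of_real p * w - of_real r * cnj w') = p * Im w + r * Im w'" for p r w w'
    by simp
  have "z * (of_real c * s) * cnj d = of_real c * (z * s) - of_real (c^3) * (z * s * cnj (z * s)) * cnj s"
    unfolding cnj_d by (simp add: algebra_simps power2_eq_square power3_eq_cube)
  also have "\<dots> = of_real c * (z * s) - of_real (c^3 * (cmod (z * s))\<^sup>2) * cnj s"
    by (simp only: complex_norm_square[symmetric] of_real_mult)
  finally show "Im (z * (of_real c * s) / denom c z s) = (c * Im (z * s) + c^3 * (cmod (z * s))\<^sup>2 * Im s) / (cmod (denom c z s))\<^sup>2"
    by (simp only: d_def[symmetric] quot Im_combination)
  have "of_real c * s * cnj d = of_real c * s - of_real (c^3) * (s * cnj s) * cnj (z * s)"
    unfolding cnj_d by (simp add: algebra_simps power2_eq_square power3_eq_cube)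
  also have "\<dots> = of_real c * s - of_real (c^3 * (cmod s)\<^sup>2) * cnj (z * s)"
    by (simp only: complex_norm_square[symmetric] of_real_mult)
  finally show "Im (of_real c * s / denom c z s) = (c * Im s + c^3 * (cmod s)\<^sup>2 * Im (z * s)) / (cmod (denom c z s))\<^sup>2"
    by (simp only: d_def[symmetric] quot Im_combination)
qed

locale positive_matrix =
  fixes R :: "complex^'m^'m" and a c :: real
  assumes hermitian: "hermitian R"
    and bounded_below: "pos_semidef (R - mat (of_real a))"
    and a_pos: "0 < a" and c_pos: "0 < c"
begin

lemma quad_form_real: "Im (quad_form R x) = 0"
  by (rule Im_quad_form_hermitian[OF hermitian])

lemma quad_form_ge: "a * (norm x)\<^sup>2 \<le> Re (quad_form R x)"
  using bounded_below unfolding pos_semidef_def quad_form_diff quad_form_mat by auto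

text \<open>
\<open>Tr (R \<Theta> \<Theta>\<^sup>*) = Tr (\<Theta>\<^sup>* R \<Theta>)\<close> is the sum of the quadratic form of \<open>R\<close> over the columns
of \<open>\<Theta>\<close>.
\<close>

lemma ntrace_mass:
  shows "ntrace (R ** \<Theta> ** conj_transpose \<Theta>) = of_real (mean_mass R \<Theta>)"
    and "a * (norm \<Theta>)\<^sup>2 \<le> real CARD('m) * mean_mass R \<Theta>"
proof -
  have *: "trace (R ** \<Theta> ** conj_transpose \<Theta>) = (\<Sum>j\<in>UNIV. quad_form R (column j \<Theta>))"
    by (metis trace_congruence trace_mul_sym matrix_mul_assoc)
  then have "Im (ntrace (R ** \<Theta> ** conj_transpose \<Theta>)) = 0"
    by (simp add: ntrace_def quad_form_real)
  then show "ntrace (R ** \<Theta> ** conj_transpose \<Theta>) = of_real (mean_mass R \<Theta>)"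
    by (simp add: mean_mass_def complex_eq_iff)
  have "(norm \<Theta>)\<^sup>2 = (\<Sum>j\<in>UNIV. (norm (column j \<Theta>))\<^sup>2)"
    unfolding norm_matrix_power2 by (subst sum.swap) (simp add: norm_vec_def L2_set_def column_def sum_nonneg)
  then have "a * (norm \<Theta>)\<^sup>2 \<le> (\<Sum>j\<in>UNIV. Re (quad_form R (column j \<Theta>)))"
    by (simp add: sum_distrib_left sum_mono quad_form_ge)
  also have "\<dots> = real CARD('m) * mean_mass R \<Theta>"
    by (simp add: mean_mass_def ntrace_def *)
  finally show "a * (norm \<Theta>)\<^sup>2 \<le> real CARD('m) * mean_mass R \<Theta>" .
qed

text \<open>
Combine \<open>a |\<Theta>|\<^sup>2 \<le> Tr (R \<Theta> \<Theta>\<^sup>*)\<close> with Cauchy--Schwarz. This transfers bounds on the energy,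
which involves \<open>R \<Theta>\<close>, to bounds on \<open>\<Theta>\<close>.
\<close>

lemma norm_le_norm_mult: "a * norm (\<Theta> :: complex^'m^'m) \<le> norm (R ** \<Theta>)"
proof (cases "\<Theta> = 0")
  case False
  have "real CARD('m) * mean_mass R \<Theta> \<le> cmod (trace (R ** \<Theta> ** conj_transpose \<Theta>))"
    by (simp add: mean_mass_def ntrace_def complex_Re_le_cmod)
  also have "\<dots> \<le> norm (R ** \<Theta>) * norm \<Theta>"
    using norm_trace_mult_le[of "R ** \<Theta>" "conj_transpose \<Theta>"] by (simp add: norm_conj_transpose)
  finally have "a * norm \<Theta> * norm \<Theta> \<le> norm (R ** \<Theta>) * norm \<Theta>"
    using ntrace_mass(2)[of \<Theta>] by (simp add: power2_eq_square mult_ac)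
  then show ?thesis using False by simp
qed simp

lemma resolvent_pair_pos:
  assumes "resolvent_pair c R z s \<Theta>"
  shows "0 < mean_mass R \<Theta>" and "0 < mean_energy R \<Theta>" and "0 < v_weight c R z s \<Theta>"
proof -
  have "(mat 1 :: complex^'m^'m) \<noteq> 0"
    by (simp add: vec_eq_iff mat_def)
  then have "\<Theta> \<noteq> 0"
    using assms by (auto simp: resolvent_pair_def)
  then have "0 < norm \<Theta>" by simp
  then have "0 < a * (norm \<Theta>)\<^sup>2" "0 < a * norm \<Theta>"
    using a_pos by simp_all
  then have "0 < real CARD('m) * mean_mass R \<Theta>" "0 < norm (R ** \<Theta>)"
    using ntrace_mass(2)[of \<Theta>] norm_le_norm_mult[of \<Theta>] by linarith+
  then show "0 < mean_mass R \<Theta>" and *: "0 < mean_energy R \<Theta>"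
    by (simp_all add: zero_less_mult_iff mean_energy_def)
  then show "0 < v_weight c R z s \<Theta>"
    using c_pos by (simp add: v_weight_def resolvent_pairD(1)[OF assms])
qed

text \<open>
Since \<open>\<Theta>\<^sup>* A\<^sup>* = -1\<close>, one has \<open>R \<Theta> = - R \<Theta> \<Theta>\<^sup>* A\<^sup>*\<close> with
\<open>A\<^sup>* = z\<^sup>* + \<gamma>\<^sup>* R\<close> and \<open>\<gamma> = z c s / d\<close>; now take normalised traces.
\<close>

lemma trace_identity:
  assumes "resolvent_pair c R z s \<Theta>"
  shows "s = - cnj z * of_real (mean_mass R \<Theta>)
     - cnj (z * (of_real c * s / denom c z s)) * of_real (mean_energy R \<Theta>)"
proof -
  define \<gamma> where "\<gamma> = z * (of_real c * s / denom c z s)"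
  define A where "A = mat z + mat \<gamma> ** R"
  have "A ** \<Theta> = - mat 1" and s: "s = ntrace (R ** \<Theta>)"
    using resolvent_pairD(2,3)[OF assms] by (simp_all only: A_def \<gamma>_def)
  then have "conj_transpose \<Theta> ** conj_transpose A = conj_transpose (- mat 1)"
    by (metis conj_transpose_mult)
  also have "\<dots> = - mat 1"
    by (auto simp: conj_transpose_def mat_def vec_eq_iff)
  finally have "R ** \<Theta> = - (R ** \<Theta> ** (conj_transpose \<Theta> ** conj_transpose A))"
    by (simp add: matrix_mult_minus_right)
  also have "conj_transpose A = mat (cnj z) + mat (cnj \<gamma>) ** R"
    using hermitian
    by (simp add: A_def conj_transpose_add conj_transpose_mat conj_transpose_mult
        hermitian_def mult_mat_eq_mat_mult)
  also have "R ** \<Theta> ** (conj_transpose \<Theta> ** (mat (cnj z) + mat (cnj \<gamma>) ** R)) =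
      mat (cnj z) ** (R ** \<Theta> ** conj_transpose \<Theta>) + mat (cnj \<gamma>) ** (R ** \<Theta> ** conj_transpose \<Theta> ** R)"
    by (simp add: matrix_mul_assoc matrix_add_ldistrib mult_mat_eq_mat_mult)
  finally have "ntrace (R ** \<Theta>) = ntrace (0 - (mat (cnj z) ** (R ** \<Theta> ** conj_transpose \<Theta>) +
      mat (cnj \<gamma>) ** (R ** \<Theta> ** conj_transpose \<Theta> ** R)))" by simp
  also have "\<dots> = - cnj z * of_real (mean_mass R \<Theta>) - cnj \<gamma> * of_real (mean_energy R \<Theta>)"
    unfolding ntrace_diff ntrace_add ntrace_mat_mult ntrace_mass(1) mean_energy_eq(2)[OF hermitian]
    by (simp add: ntrace_def trace_def)
  finally show ?thesis unfolding s[symmetric] \<gamma>_def .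
qed

text \<open>
The first equation is the imaginary part of the trace identity, the second the imaginary part of
\<open>z\<close> times it, where \<open>z z\<^sup>*\<close> is real. Both hold for every complex \<open>z\<close>, in particular on the real axis.
\<close>

lemma imaginary_part_system:
  assumes "resolvent_pair c R z s \<Theta>"
  shows "(1 - u_weight c R z s \<Theta>) * Im s - v_weight c R z s \<Theta> * Im (z * s) = Im z * mean_mass R \<Theta>"
    and "(1 - u_weight c R z s \<Theta>) * Im (z * s) = (cmod z)\<^sup>2 * v_weight c R z s \<Theta> * Im s"
proof -
  define d where "d = denom c z s"
  define W where "W = mean_energy R \<Theta>"
  define q where "q = mean_mass R \<Theta>"
  have d: "d \<noteq> 0" using resolvent_pairD(1)[OF assms] by (simp add: d_def)
  have s: "s = - cnj z * of_real q - cnj (z * (of_real c * s / d)) * of_real W"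
    using trace_identity[OF assms] by (simp add: d_def W_def q_def)
  have u: "u_weight c R z s \<Theta> = c^3 * (cmod (z * s))\<^sup>2 * W / (cmod d)\<^sup>2"
    by (simp add: u_weight_def d_def W_def norm_mult power_mult_distrib power2_eq_square power3_eq_cube)
  have v: "v_weight c R z s \<Theta> = c * W / (cmod d)\<^sup>2"
    by (simp add: v_weight_def d_def W_def)
  note 1 = Im_coupling(1)[of z c s, folded d_def] and 2 = Im_coupling(2)[of c s z, folded d_def]
  have Im_conj: "Im (- cnj z * of_real q - cnj w * of_real W) = Im z * q + Im w * W" for w
    by simp
  have "Im s = Im (- cnj z * of_real q - cnj (z * (of_real c * s / d)) * of_real W)"
    by (rule arg_cong[OF s])
  also have "\<dots> = Im z * q + Im (z * (of_real c * s) / d) * W"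
    by (simp only: Im_conj times_divide_eq_right)
  finally show "(1 - u_weight c R z s \<Theta>) * Im s - v_weight c R z s \<Theta> * Im (z * s) = Im z * mean_mass R \<Theta>"
    unfolding 1 u v q_def[symmetric] by (simp add: field_simps add_divide_distrib)
  have "z * s = - (z * cnj z) * of_real q - (z * cnj z) * cnj (of_real c * s / d) * of_real W"
    by (subst s) (simp add: algebra_simps)
  also have "\<dots> = of_real (- (cmod z)\<^sup>2 * q) - of_real ((cmod z)\<^sup>2 * W) * cnj (of_real c * s / d)"
    by (simp only: complex_norm_square[symmetric] of_real_mult of_real_minus) (simp add: mult_ac)
  finally have *: "z * s = of_real (- (cmod z)\<^sup>2 * q) - of_real ((cmod z)\<^sup>2 * W) * cnj (of_real c * s / d)" .
  have Im_conj': "Im (of_real p - of_real r * cnj w) = r * Im w" for p r w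
    by simp
  define I where "I = Im (z * s)"
  have "I = (cmod z)\<^sup>2 * W * ((c * Im s + c^3 * (cmod s)\<^sup>2 * I) / (cmod d)\<^sup>2)"
    unfolding I_def 2[symmetric] by (subst *) (rule Im_conj')
  moreover have "(1 - u_weight c R z s \<Theta>) * I - (cmod z)\<^sup>2 * v_weight c R z s \<Theta> * Im s =
      I - (cmod z)\<^sup>2 * W * ((c * Im s + c^3 * (cmod s)\<^sup>2 * I) / (cmod d)\<^sup>2)"
    unfolding u v norm_mult power_mult_distrib
    by (simp add: algebra_simps add_divide_distrib)
  ultimately have "(1 - u_weight c R z s \<Theta>) * I - (cmod z)\<^sup>2 * v_weight c R z s \<Theta> * Im s = 0"
    by linarith
  then show "(1 - u_weight c R z s \<Theta>) * Im (z * s) = (cmod z)\<^sup>2 * v_weight c R z s \<Theta> * Im s"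
    by (simp only: I_def eq_iff_diff_eq_0[symmetric])
qed

text \<open>
Elimination of \<open>Im (z s)\<close> from the linear system.
\<close>

lemma discriminant_identity:
  assumes "resolvent_pair c R z s \<Theta>"
  shows "((1 - u_weight c R z s \<Theta>)\<^sup>2 - (cmod z)\<^sup>2 * (v_weight c R z s \<Theta>)\<^sup>2) * Im s =
    (1 - u_weight c R z s \<Theta>) * Im z * mean_mass R \<Theta>"
proof -
  let ?u = "u_weight c R z s \<Theta>" and ?v = "v_weight c R z s \<Theta>"
  have "(1 - ?u) * Im z * mean_mass R \<Theta> = (1 - ?u) * ((1 - ?u) * Im s - ?v * Im (z * s))"
    unfolding imaginary_part_system(1)[OF assms] by (simp add: mult.assoc)
  also have "\<dots> = (1 - ?u)\<^sup>2 * Im s - ?v * ((1 - ?u) * Im (z * s))"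
    by (simp add: algebra_simps power2_eq_square)
  also have "\<dots> = ((1 - ?u)\<^sup>2 - (cmod z)\<^sup>2 * ?v\<^sup>2) * Im s"
    unfolding imaginary_part_system(2)[OF assms] by (simp add: algebra_simps power2_eq_square)
  finally show ?thesis by simp
qed

text \<open>
The second equation of the system determines the sign of \<open>1 - u\<close>, and then the discriminant
identity that of \<open>(1 - u)\<^sup>2 - |z|\<^sup>2 v\<^sup>2\<close>.
\<close>

lemma weights_upper_half_plane:
  assumes pair: "resolvent_pair c R z s \<Theta>"
    and "0 < Im z" and "0 < Im s" and "0 < Im (z * s)"
  shows "u_weight c R z s \<Theta> + cmod z * v_weight c R z s \<Theta> < 1"
proof -
  let ?u = "u_weight c R z s \<Theta>" and ?v = "v_weight c R z s \<Theta>"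
  have v: "0 < ?v" by (rule resolvent_pair_pos[OF pair])
  have "z \<noteq> 0" using assms by auto
  then have "0 < (1 - ?u) * Im (z * s)"
    unfolding imaginary_part_system(2)[OF pair] using v assms by simp
  then have u: "0 < 1 - ?u" using assms by (simp add: zero_less_mult_iff)
  have "0 < ((1 - ?u)\<^sup>2 - (cmod z)\<^sup>2 * ?v\<^sup>2) * Im s"
    unfolding discriminant_identity[OF pair] using u assms resolvent_pair_pos(1)[OF pair] by simp
  then have "(cmod z * ?v)\<^sup>2 < (1 - ?u)\<^sup>2"
    using assms by (simp add: zero_less_mult_iff power_mult_distrib)
  then have "cmod z * ?v < 1 - ?u"
    using u by (simp add: power2_less_imp_less)
  then show ?thesis by simp
qed

end

section \<open>Real boundary points: closedness, uniqueness, bounds\<close>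

text \<open>
All conditions are limits of closed ones except \<open>denom \<noteq> 0\<close>, which the energy inequality
restores: a vanishing denominator would kill the energy, hence \<open>s\<close>, and \<open>denom\<close> is \<open>1\<close> at
\<open>s = 0\<close>. The filter \<open>G\<close> is arbitrary so that the lemma also applies to limit points.
\<close>

lemma resolvent_pair_tendsto:
  assumes "G \<noteq> bot" and "z0 \<noteq> 0" and "0 < c"
    and lim: "(\<zeta> \<longlongrightarrow> z0) G" "(\<sigma> \<longlongrightarrow> s) G" "(\<Psi> \<longlongrightarrow> \<Theta>) G"
    and pairs: "\<forall>\<^sub>F y in G. resolvent_pair c R (\<zeta> y) (\<sigma> y) (\<Psi> y) \<and>
      u_weight c R (\<zeta> y) (\<sigma> y) (\<Psi> y) + cmod (\<zeta> y) * v_weight c R (\<zeta> y) (\<sigma> y) (\<Psi> y) \<le> 1"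
  shows "resolvent_pair c R z0 s \<Theta>"
    and "u_weight c R z0 s \<Theta> + cmod z0 * v_weight c R z0 s \<Theta> \<le> 1"
proof -
  note nb [simp] = \<open>G \<noteq> bot\<close>
  have lim_d: "((\<lambda>y. denom c (\<zeta> y) (\<sigma> y)) \<longlongrightarrow> denom c z0 s) G"
    unfolding denom_def by (intro tendsto_intros lim)
  have lim_W: "((\<lambda>y. mean_energy R (\<Psi> y)) \<longlongrightarrow> mean_energy R \<Theta>) G"
    unfolding mean_energy_def by (intro tendsto_intros lim) simp
  have "((\<lambda>y. ntrace (R ** \<Psi> y)) \<longlongrightarrow> ntrace (R ** \<Theta>)) G"
    by (intro tendsto_intros lim)
  moreover have "\<forall>\<^sub>F y in G. ntrace (R ** \<Psi> y) = \<sigma> y"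
    using pairs by eventually_elim (use resolvent_pairD(3) in force)
  ultimately have "(\<sigma> \<longlongrightarrow> ntrace (R ** \<Theta>)) G"
    by (rule Lim_transform_eventually)
  then have s: "s = ntrace (R ** \<Theta>)"
    by (rule tendsto_unique[OF nb lim(2)])
  \<comment> \<open>Stated without division, since \<open>denom c z0 s \<noteq> 0\<close> is still to be shown.\<close>
  have energy: "c * ((cmod (of_real c * z0 * s))\<^sup>2 + cmod z0) * mean_energy R \<Theta> \<le> (cmod (denom c z0 s))\<^sup>2"
  proof (rule tendsto_le[OF nb])
    show "((\<lambda>y. c * ((cmod (of_real c * \<zeta> y * \<sigma> y))\<^sup>2 + cmod (\<zeta> y)) * mean_energy R (\<Psi> y)) \<longlongrightarrow>
        c * ((cmod (of_real c * z0 * s))\<^sup>2 + cmod z0) * mean_energy R \<Theta>) G"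
      by (intro tendsto_intros lim lim_W)
    show "((\<lambda>y. (cmod (denom c (\<zeta> y) (\<sigma> y)))\<^sup>2) \<longlongrightarrow> (cmod (denom c z0 s))\<^sup>2) G"
      by (intro tendsto_intros lim_d)
    show "\<forall>\<^sub>F y in G. c * ((cmod (of_real c * \<zeta> y * \<sigma> y))\<^sup>2 + cmod (\<zeta> y)) * mean_energy R (\<Psi> y)
        \<le> (cmod (denom c (\<zeta> y) (\<sigma> y)))\<^sup>2"
      using pairs by eventually_elim (use weights_le_iff resolvent_pairD(1) in blast)
  qed
  have d: "denom c z0 s \<noteq> 0"
  proof
    assume 0: "denom c z0 s = 0"
    have "0 < c * ((cmod (of_real c * z0 * s))\<^sup>2 + cmod z0)"
      using \<open>0 < c\<close> \<open>z0 \<noteq> 0\<close> by (simp add: add_nonneg_pos)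
    then have "0 < c * ((cmod (of_real c * z0 * s))\<^sup>2 + cmod z0) * mean_energy R \<Theta>" if "0 < mean_energy R \<Theta>"
      using that by (rule mult_pos_pos)
    then have "mean_energy R \<Theta> \<le> 0"
      using energy unfolding 0 norm_zero power_zero_numeral by linarith
    then have "(cmod s)\<^sup>2 \<le> 0"
      using cmod_ntrace_power2_le_mean_energy[of R \<Theta>] unfolding s by (rule order_trans[rotated])
    then show False using 0 by (simp add: denom_def)
  qed
  have "((\<lambda>y. (mat (\<zeta> y) + mat (\<zeta> y * (of_real c * \<sigma> y / denom c (\<zeta> y) (\<sigma> y))) ** R) ** \<Psi> y) \<longlongrightarrow>
      (mat z0 + mat (z0 * (of_real c * s / denom c z0 s)) ** R) ** \<Theta>) G"
    by (intro tendsto_intros lim lim_d d)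
  moreover have "\<forall>\<^sub>F y in G. (mat (\<zeta> y) + mat (\<zeta> y * (of_real c * \<sigma> y / denom c (\<zeta> y) (\<sigma> y))) ** R) ** \<Psi> y = - mat 1"
    using pairs by eventually_elim (use resolvent_pairD(2) in blast)
  ultimately have "((\<lambda>y. - mat 1) \<longlongrightarrow> (mat z0 + mat (z0 * (of_real c * s / denom c z0 s)) ** R) ** \<Theta>) G"
    by (rule Lim_transform_eventually)
  then have "(mat z0 + mat (z0 * (of_real c * s / denom c z0 s)) ** R) ** \<Theta> = - mat 1"
    by (simp only: tendsto_const_iff[OF nb])
  then show "resolvent_pair c R z0 s \<Theta>"
    using d s unfolding resolvent_pair_def by blast
  show "u_weight c R z0 s \<Theta> + cmod z0 * v_weight c R z0 s \<Theta> \<le> 1"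
    using energy by (simp add: weights_le_iff[OF d])
qed

lemma resolvent_pair_right_inverse:
  assumes "resolvent_pair c R z s \<Theta>"
  shows "(mat z + mat (z * (of_real c * s / denom c z s)) ** R) ** (- \<Theta>) = mat 1"
    and "(- \<Theta>) ** (mat z + mat (z * (of_real c * s / denom c z s)) ** R) = mat 1"
proof -
  let ?A = "mat z + mat (z * (of_real c * s / denom c z s)) ** R"
  have "?A ** (- \<Theta>) = - (?A ** \<Theta>)"
    by (rule matrix_mult_minus_right)
  then show "?A ** (- \<Theta>) = mat 1"
    by (simp only: resolvent_pairD(2)[OF assms]) simp
  then show "(- \<Theta>) ** ?A = mat 1"
    by (simp only: matrix_left_right_inverse)
qed

lemma resolvent_pair_unique_matrix:
  assumes "resolvent_pair c R z s \<Theta>" and "resolvent_pair c R z s \<Psi>"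
  shows "\<Theta> = \<Psi>"
  using resolvent_pair_right_inverse[OF assms(1)] resolvent_pair_right_inverse[OF assms(2)]
  by (metis matrix_mul_assoc matrix_mul_lid matrix_mul_rid neg_equal_iff_equal)

text \<open>
The resolvent identity \<open>\<Theta>\<^sub>1 - \<Theta>\<^sub>2 = \<Theta>\<^sub>1 (A\<^sub>1 - A\<^sub>2) \<Theta>\<^sub>2\<close>, multiplied by \<open>R\<close>, traced and
cleared of denominators.
\<close>

lemma resolvent_pair_difference:
  assumes 1: "resolvent_pair c R z s1 \<Theta>1" and 2: "resolvent_pair c R z s2 \<Theta>2"
  shows "(s1 - s2) * (denom c z s1 * denom c z s2) =
    z * of_real c * (s1 - s2) * (1 + z * (of_real c)\<^sup>2 * s1 * s2) * ntrace (R ** \<Theta>1 ** (R ** \<Theta>2))"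
proof -
  define \<beta>1 where "\<beta>1 = of_real c * s1 / denom c z s1"
  define \<beta>2 where "\<beta>2 = of_real c * s2 / denom c z s2"
  define A1 where "A1 = mat z + mat (z * \<beta>1) ** R"
  define A2 where "A2 = mat z + mat (z * \<beta>2) ** R"
  have inv: "(- \<Theta>1) ** A1 = mat 1" "A2 ** (- \<Theta>2) = mat 1"
    using resolvent_pair_right_inverse[OF 1] resolvent_pair_right_inverse[OF 2]
    by (simp_all only: A1_def A2_def \<beta>1_def \<beta>2_def)
  have "A1 - A2 = mat (z * (\<beta>1 - \<beta>2)) ** R"
    by (simp add: A1_def A2_def vec_eq_iff mat_mult_nth algebra_simps)
  then have "mat (z * (\<beta>1 - \<beta>2)) ** (R ** \<Theta>1 ** (R ** \<Theta>2)) = R ** (- \<Theta>1) ** (A1 - A2) ** (- \<Theta>2)"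
    by (simp add: matrix_mul_assoc mult_mat_eq_mat_mult matrix_mult_minus_right matrix_mult_minus_left)
  also have "\<dots> = R ** ((- \<Theta>1) ** A1) ** (- \<Theta>2) - R ** (- \<Theta>1) ** (A2 ** (- \<Theta>2))"
    by (simp only: matrix_mul_assoc matrix_diff_ldistrib matrix_diff_rdistrib)
  also have "\<dots> = R ** \<Theta>1 - R ** \<Theta>2"
    unfolding inv by (simp add: matrix_mult_minus_right)
  finally have "ntrace (mat (z * (\<beta>1 - \<beta>2)) ** (R ** \<Theta>1 ** (R ** \<Theta>2))) = s1 - s2"
    by (simp only: ntrace_diff resolvent_pairD(3)[OF 1, symmetric] resolvent_pairD(3)[OF 2, symmetric])
  then have eq: "s1 - s2 = z * (\<beta>1 - \<beta>2) * ntrace (R ** \<Theta>1 ** (R ** \<Theta>2))"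
    by (simp only: ntrace_mat_mult)
  have "(\<beta>1 - \<beta>2) * (denom c z s1 * denom c z s2) = of_real c * (s1 * denom c z s2 - s2 * denom c z s1)"
    using resolvent_pairD(1)[OF 1] resolvent_pairD(1)[OF 2] by (simp add: \<beta>1_def \<beta>2_def field_simps)
  also have "\<dots> = of_real c * (s1 - s2) * (1 + z * (of_real c)\<^sup>2 * s1 * s2)"
    by (simp add: denom_def algebra_simps power2_eq_square)
  finally have *: "(\<beta>1 - \<beta>2) * (denom c z s1 * denom c z s2) = of_real c * (s1 - s2) * (1 + z * (of_real c)\<^sup>2 * s1 * s2)" .
  have "(s1 - s2) * (denom c z s1 * denom c z s2) =
      z * ((\<beta>1 - \<beta>2) * (denom c z s1 * denom c z s2)) * ntrace (R ** \<Theta>1 ** (R ** \<Theta>2))"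
    by (subst eq) (simp add: mult_ac)
  then show ?thesis
    unfolding * by (simp add: mult_ac)
qed

text \<open>
The hypothesis reverses Cauchy--Schwarz for the vectors \<open>(1, \<surd>k p)\<close> and \<open>(1, \<surd>k q\<^sup>*)\<close>, whose
first entries agree; the defect is exactly \<open>k |p - q\<^sup>*|\<^sup>2\<close>.
\<close>

lemma cnj_eq_if_Cauchy_Schwarz_equality:
  fixes k :: real and p q :: complex
  assumes "0 < k"
    and "(1 + k * (cmod p)\<^sup>2) * (1 + k * (cmod q)\<^sup>2) \<le> (cmod (1 + of_real k * p * q))\<^sup>2"
  shows "p = cnj q"
proof -
  have "(1 + k * (cmod p)\<^sup>2) * (1 + k * (cmod q)\<^sup>2) - (cmod (1 + of_real k * p * q))\<^sup>2 =
      k * ((Re p - Re q)\<^sup>2 + (Im p + Im q)\<^sup>2)"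
    unfolding cmod_power2 by (simp add: algebra_simps power2_eq_square)
  then have "(Re p - Re q)\<^sup>2 + (Im p + Im q)\<^sup>2 \<le> 0"
    using assms by (smt (verit) mult_pos_pos)
  then have "Re p - Re q = 0 \<and> Im p + Im q = 0"
    by (simp add: sum_power2_le_zero_iff)
  then show ?thesis by (simp add: complex_eq_iff)
qed

context positive_matrix
begin

text \<open>
If \<open>s1 \<noteq> s2\<close>, the difference formula can be divided by \<open>s1 - s2\<close>. Bounding its trace by
Cauchy--Schwarz and its denominators by the energy inequality yields the reversed
Cauchy--Schwarz inequality of the previous lemma. Positivity of \<open>x\<close> enters through
\<open>k = x c\<^sup>2 > 0\<close>, and the sign of the imaginary parts turns \<open>s1 = s2\<^sup>*\<close> into \<open>s1 = s2\<close>.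
\<close>

lemma boundary_pair_unique:
  fixes x :: real
  assumes "0 < x"
    and 1: "resolvent_pair c R (of_real x) s1 \<Theta>1" "0 \<le> Im s1"
      "u_weight c R (of_real x) s1 \<Theta>1 + x * v_weight c R (of_real x) s1 \<Theta>1 \<le> 1"
    and 2: "resolvent_pair c R (of_real x) s2 \<Theta>2" "0 \<le> Im s2"
      "u_weight c R (of_real x) s2 \<Theta>2 + x * v_weight c R (of_real x) s2 \<Theta>2 \<le> 1"
  shows "s1 = s2 \<and> \<Theta>1 = \<Theta>2"
proof -
  have "s1 = s2"
  proof (rule ccontr)
    assume "s1 \<noteq> s2"
    define k where "k = x * c\<^sup>2"
    define \<tau> where "\<tau> = ntrace (R ** \<Theta>1 ** (R ** \<Theta>2))"
    define W1 where "W1 = mean_energy R \<Theta>1"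
    define W2 where "W2 = mean_energy R \<Theta>2"
    let ?d1 = "denom c (of_real x) s1" and ?d2 = "denom c (of_real x) s2"
    have "0 < k" using \<open>0 < x\<close> c_pos by (simp add: k_def)
    have W: "0 < W1" "0 < W2"
      using resolvent_pair_pos(2) 1 2 by (auto simp: W1_def W2_def)
    have "?d1 * ?d2 = of_real (x * c) * (1 + of_real k * s1 * s2) * \<tau>"
      using resolvent_pair_difference[OF 1(1) 2(1)] \<open>s1 \<noteq> s2\<close>
      by (simp add: \<tau>_def k_def)
    then have eq: "(cmod ?d1)\<^sup>2 * (cmod ?d2)\<^sup>2 = (x * c)\<^sup>2 * (cmod (1 + of_real k * s1 * s2))\<^sup>2 * (cmod \<tau>)\<^sup>2"
      by (metis norm_mult power_mult_distrib norm_of_real power2_abs)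
    have "cmod \<tau> \<le> norm (R ** \<Theta>1) * norm (R ** \<Theta>2) / real CARD('m)"
      unfolding \<tau>_def ntrace_def using norm_trace_mult_le[of "R ** \<Theta>1" "R ** \<Theta>2"]
      by (simp add: norm_divide divide_right_mono)
    then have "(cmod \<tau>)\<^sup>2 \<le> (norm (R ** \<Theta>1) * norm (R ** \<Theta>2) / real CARD('m))\<^sup>2"
      by (intro power_mono) auto
    then have tau: "(cmod \<tau>)\<^sup>2 \<le> W1 * W2"
      by (simp add: W1_def W2_def mean_energy_def power_divide power_mult_distrib power2_eq_square mult_ac)
    have energy: "x * c * (1 + k * (cmod s)\<^sup>2) * mean_energy R \<Theta> \<le> (cmod (denom c (of_real x) s))\<^sup>2"
      if pair: "resolvent_pair c R (of_real x) s \<Theta>"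
        and "u_weight c R (of_real x) s \<Theta> + x * v_weight c R (of_real x) s \<Theta> \<le> 1" for s \<Theta>
    proof -
      have "c * ((cmod (of_real c * of_real x * s))\<^sup>2 + cmod (of_real x)) * mean_energy R \<Theta>
          \<le> (cmod (denom c (of_real x) s))\<^sup>2"
        using that(2) \<open>0 < x\<close> iffD1[OF weights_le_iff[OF resolvent_pairD(1)[OF pair], of R \<Theta>]] by simp
      moreover have "c * ((cmod (of_real c * of_real x * s))\<^sup>2 + cmod (of_real x)) = x * c * (1 + k * (cmod s)\<^sup>2)"
        using \<open>0 < x\<close> c_pos by (simp add: k_def norm_mult power2_eq_square algebra_simps)
      ultimately show ?thesis by (simp only:)
    qed
    have "(x * c * (1 + k * (cmod s1)\<^sup>2) * W1) * (x * c * (1 + k * (cmod s2)\<^sup>2) * W2) \<le>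
        (cmod ?d1)\<^sup>2 * (cmod ?d2)\<^sup>2"
      using energy[OF 1(1,3)] energy[OF 2(1,3)] \<open>0 < x\<close> c_pos \<open>0 < k\<close> W
      unfolding W1_def W2_def by (intro mult_mono) auto
    also have "\<dots> \<le> (x * c)\<^sup>2 * (cmod (1 + of_real k * s1 * s2))\<^sup>2 * (W1 * W2)"
      unfolding eq using tau by (intro mult_left_mono) auto
    finally have "((x * c)\<^sup>2 * (W1 * W2)) * ((1 + k * (cmod s1)\<^sup>2) * (1 + k * (cmod s2)\<^sup>2)) \<le>
        ((x * c)\<^sup>2 * (W1 * W2)) * (cmod (1 + of_real k * s1 * s2))\<^sup>2"
      by (simp add: power2_eq_square mult_ac)
    then have "(1 + k * (cmod s1)\<^sup>2) * (1 + k * (cmod s2)\<^sup>2) \<le> (cmod (1 + of_real k * s1 * s2))\<^sup>2"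
      using W \<open>0 < x\<close> c_pos by (subst (asm) mult_le_cancel_left_pos) auto
    then have "s1 = cnj s2"
      by (rule cnj_eq_if_Cauchy_Schwarz_equality[OF \<open>0 < k\<close>])
    then have "s1 = s2"
      using 1(2) 2(2) by (simp add: complex_eq_iff)
    with \<open>s1 \<noteq> s2\<close> show False by contradiction
  qed
  with 1 2 show ?thesis using resolvent_pair_unique_matrix by blast
qed

text \<open>
For large \<open>s\<close> the coupling \<open>\<beta> = c s / d\<close> is of order \<open>1 / s\<close>, so \<open>\<Theta>\<close> is close to \<open>- 1 / z\<close> and
\<open>s = (1/M) Tr (R \<Theta>)\<close> is bounded. The four summands of the bound are the sizes beyond which,
respectively, \<open>|s|\<^sup>2 \<ge> |s|\<close>, the quadratic term dominates \<open>d\<close>, \<open>|\<beta>| |R| \<le> 1/2\<close>, and \<open>|s|\<close> exceeds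
the resulting bound \<open>2 |R| / |z|\<close>.
\<close>

lemma resolvent_pair_trace_bounded:
  assumes pair: "resolvent_pair c R z s \<Theta>" and "0 < \<delta>" and "\<delta> \<le> cmod z"
  shows "cmod s \<le> 1 + 2 / (\<delta> * c\<^sup>2) + 4 * norm R / (\<delta> * c) + 2 * norm R / \<delta>" (is "_ \<le> ?B")
proof (rule ccontr)
  assume "\<not> cmod s \<le> ?B"
  moreover have "0 \<le> 2 / (\<delta> * c\<^sup>2)" "0 \<le> 4 * norm R / (\<delta> * c)" "0 \<le> 2 * norm R / \<delta>"
    using \<open>0 < \<delta>\<close> c_pos by simp_all
  ultimately have s: "1 < cmod s" "2 / (\<delta> * c\<^sup>2) < cmod s" "4 * norm R / (\<delta> * c) < cmod s"
      "2 * norm R / \<delta> < cmod s"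
    by linarith+
  define d where "d = denom c z s"
  define \<beta> where "\<beta> = of_real c * s / d"
  have d: "d \<noteq> 0" using resolvent_pairD(1)[OF pair] by (simp add: d_def)
  have z: "0 < cmod z" using assms by linarith
  have "2 < \<delta> * c\<^sup>2 * cmod s"
    using s(2) \<open>0 < \<delta>\<close> c_pos by (simp add: field_simps)
  also have "\<dots> \<le> cmod z * c\<^sup>2 * (cmod s)\<^sup>2"
    using s(1) assms(2,3) by (simp add: power2_eq_square mult_mono mult_le_cancel_left1)
  finally have big: "2 \<le> cmod z * c\<^sup>2 * (cmod s)\<^sup>2" by simp
  have "cmod z * c\<^sup>2 * (cmod s)\<^sup>2 - 1 \<le> cmod d"
    using norm_triangle_ineq2[of "z * (of_real c)\<^sup>2 * s\<^sup>2" 1]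
    by (simp add: d_def denom_def norm_mult norm_power norm_minus_commute)
  with big have d_ge: "cmod z * c\<^sup>2 * (cmod s)\<^sup>2 \<le> 2 * cmod d" by simp
  have "4 * norm R < \<delta> * c * cmod s"
    using s(3) \<open>0 < \<delta>\<close> c_pos by (simp add: field_simps)
  also have "\<dots> \<le> cmod z * c * cmod s"
    using assms(2,3) c_pos by (intro mult_right_mono) auto
  finally have "(4 * norm R) * (c * cmod s) \<le> (cmod z * c * cmod s) * (c * cmod s)"
    using c_pos by (intro mult_right_mono) auto
  also have "\<dots> \<le> 2 * cmod d"
    using d_ge by (simp add: power2_eq_square mult_ac)
  finally have "2 * norm R * (c * cmod s) \<le> cmod d" by (simp add: mult_ac)
  then have beta: "cmod \<beta> * norm R \<le> 1 / 2"
    using d c_pos by (simp add: \<beta>_def norm_divide norm_mult field_simps)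
  have "(mat z + mat (z * \<beta>) ** R) ** \<Theta> = - mat 1"
    using resolvent_pairD(2)[OF pair] by (simp only: \<beta>_def d_def)
  then have "R ** ((mat z + mat (z * \<beta>) ** R) ** \<Theta>) = R ** (- mat 1)" by simp
  then have "mat z ** (R ** \<Theta>) + mat (z * \<beta>) ** (R ** (R ** \<Theta>)) = R ** (- mat 1)"
    by (simp only: matrix_add_ldistrib matrix_add_rdistrib matrix_mul_assoc mult_mat_eq_mat_mult)
  also have "R ** (- mat 1) = - R"
    by (simp add: matrix_mult_minus_right)
  finally have "mat z ** (R ** \<Theta>) = - R - mat (z * \<beta>) ** (R ** (R ** \<Theta>))"
    by (simp add: eq_diff_eq)
  then have "cmod z * norm (R ** \<Theta>) = norm (- R - mat (z * \<beta>) ** (R ** (R ** \<Theta>)))"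
    by (metis norm_mat_mult)
  also have "\<dots> \<le> norm R + cmod z * cmod \<beta> * norm (R ** (R ** \<Theta>))"
    using norm_triangle_ineq4[of "- R" "mat (z * \<beta>) ** (R ** (R ** \<Theta>))"]
    by (simp add: norm_mat_mult norm_mult)
  also have "\<dots> \<le> norm R + cmod z * cmod \<beta> * (norm R * norm (R ** \<Theta>))"
    by (intro add_left_mono mult_left_mono norm_matrix_mult_le) auto
  also have "\<dots> = norm R + (cmod z * norm (R ** \<Theta>)) * (cmod \<beta> * norm R)"
    by simp
  also have "\<dots> \<le> norm R + (cmod z * norm (R ** \<Theta>)) * (1 / 2)"
    using beta by (intro add_left_mono mult_left_mono) auto
  finally have "cmod z * norm (R ** \<Theta>) \<le> 2 * norm R" by simp
  moreover have "\<delta> * norm (R ** \<Theta>) \<le> cmod z * norm (R ** \<Theta>)"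
    using assms by (intro mult_right_mono) auto
  ultimately have RT: "norm (R ** \<Theta>) \<le> 2 * norm R / \<delta>"
    using \<open>0 < \<delta>\<close> by (simp add: field_simps)
  have "(cmod s)\<^sup>2 \<le> (norm (R ** \<Theta>))\<^sup>2 / real CARD('m)"
    using norm_ntrace_power2_le[of "R ** \<Theta>"] resolvent_pairD(3)[OF pair] by simp
  moreover have "1 \<le> real CARD('m)"
    by (simp add: Suc_le_eq)
  then have "(norm (R ** \<Theta>))\<^sup>2 / real CARD('m) \<le> (norm (R ** \<Theta>))\<^sup>2 / 1"
    by (intro divide_left_mono) auto
  ultimately have "(cmod s)\<^sup>2 \<le> (norm (R ** \<Theta>))\<^sup>2"
    unfolding div_by_1 by (rule order_trans)
  then have "cmod s \<le> norm (R ** \<Theta>)"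
    by (rule power2_le_imp_le) simp
  with RT s(4) show False by linarith
qed

text \<open>
Once \<open>s\<close> is bounded so is \<open>d\<close>, and the energy inequality bounds \<open>R \<Theta>\<close>.
\<close>

lemma resolvent_pair_bounded:
  assumes "0 < \<delta>"
  obtains K where "\<And>z s \<Theta>. resolvent_pair c R z s \<Theta> \<Longrightarrow> \<delta> \<le> cmod z \<Longrightarrow> cmod z \<le> r \<Longrightarrow>
     u_weight c R z s \<Theta> + cmod z * v_weight c R z s \<Theta> \<le> 1 \<Longrightarrow> norm (s, \<Theta>) \<le> K"
proof -
  define B where "B = 1 + 2 / (\<delta> * c\<^sup>2) + 4 * norm R / (\<delta> * c) + 2 * norm R / \<delta>"
  define D where "D = real CARD('m) * (1 + r * c\<^sup>2 * B\<^sup>2)\<^sup>2 / (c * \<delta>)"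
  have bound: "norm (s, \<Theta>) \<le> B + sqrt D / a"
    if pair: "resolvent_pair c R z s \<Theta>" and z: "\<delta> \<le> cmod z" "cmod z \<le> r"
      and le: "u_weight c R z s \<Theta> + cmod z * v_weight c R z s \<Theta> \<le> 1" for z s \<Theta>
  proof -
    have s: "cmod s \<le> B"
      unfolding B_def by (rule resolvent_pair_trace_bounded[OF pair \<open>0 < \<delta>\<close> z(1)])
    have "cmod (denom c z s) \<le> 1 + cmod z * c\<^sup>2 * (cmod s)\<^sup>2"
      unfolding denom_def by (rule order_trans[OF norm_triangle_ineq4]) (simp add: norm_mult norm_power)
    also have "\<dots> \<le> 1 + r * c\<^sup>2 * B\<^sup>2"
      using s z \<open>0 < \<delta>\<close> c_pos by (intro add_left_mono mult_mono power_mono) auto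
    finally have d: "(cmod (denom c z s))\<^sup>2 \<le> (1 + r * c\<^sup>2 * B\<^sup>2)\<^sup>2"
      by (intro power_mono) auto
    have "c * \<delta> * mean_energy R \<Theta> \<le> c * ((cmod (of_real c * z * s))\<^sup>2 + cmod z) * mean_energy R \<Theta>"
      using z c_pos by (intro mult_right_mono mult_left_mono mean_energy_nonneg) (simp_all add: add_increasing)
    also have "\<dots> \<le> (1 + r * c\<^sup>2 * B\<^sup>2)\<^sup>2"
      using le d weights_le_iff[OF resolvent_pairD(1)[OF pair]] by (meson order_trans)
    finally have "(norm (R ** \<Theta>))\<^sup>2 \<le> D"
      using c_pos \<open>0 < \<delta>\<close> by (simp add: mean_energy_def D_def field_simps)
    then have "norm (R ** \<Theta>) \<le> sqrt D"
      by (rule real_le_rsqrt)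
    then have "norm \<Theta> \<le> sqrt D / a"
      using norm_le_norm_mult[of \<Theta>] a_pos by (simp add: field_simps)
    then show ?thesis
      using norm_Pair_le[of s \<Theta>] s by simp
  qed
  from that[OF bound] show thesis .
qed

end

text \<open>
A compactly bounded function with only one possible limit point converges: if it stayed away from
\<open>l\<close> frequently, compactness would supply another limit point along a finer filter.
\<close>

lemma tendsto_if_unique_cluster_point:
  fixes f :: "'x \<Rightarrow> 'y::topological_space"
  assumes "F \<noteq> bot" and "compact K" and "\<forall>\<^sub>F x in F. f x \<in> K"
    and cluster: "\<And>G y. G \<le> F \<Longrightarrow> G \<noteq> bot \<Longrightarrow> (f \<longlongrightarrow> y) G \<Longrightarrow> P y"
    and unique: "\<And>y y'. P y \<Longrightarrow> P y' \<Longrightarrow> y = y'"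
  shows "\<exists>l. (f \<longlongrightarrow> l) F"
proof -
  have subfilter: "\<exists>y H. H \<le> G \<and> H \<noteq> bot \<and> (f \<longlongrightarrow> y) H \<and> P y" if G: "G \<le> F" "G \<noteq> bot" for G
  proof -
    have "\<forall>\<^sub>F y in filtermap f G. y \<in> K"
      using assms(3) G(1) by (simp add: eventually_filtermap filter_leD)
    moreover have "filtermap f G \<noteq> bot"
      using G(2) by (simp add: filtermap_bot_iff)
    ultimately obtain y where y: "inf (nhds y) (filtermap f G) \<noteq> bot"
      using \<open>compact K\<close> unfolding compact_filter by blast
    \<comment> \<open>The coarsest filter below \<open>G\<close> along which \<open>f\<close> tends to \<open>y\<close>.\<close>
    define H where "H = inf G (filtercomap f (nhds y))"
    have "H \<noteq> bot"
    proof
      assume "H = bot"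
      then obtain Q R where Q: "eventually Q G" and R: "eventually R (nhds y)"
        and QR: "\<And>x. Q x \<Longrightarrow> R (f x) \<Longrightarrow> False"
        unfolding H_def trivial_limit_def eventually_inf eventually_filtercomap by blast
      have "\<forall>\<^sub>F x in G. \<not> R (f x)"
        using Q by eventually_elim (use QR in blast)
      then have "eventually (\<lambda>y. \<not> R y) (filtermap f G)"
        by (simp add: eventually_filtermap)
      with R have "eventually (\<lambda>_. False) (inf (nhds y) (filtermap f G))"
        unfolding eventually_inf by blast
      with y show False by (simp add: trivial_limit_def)
    qed
    moreover have "(f \<longlongrightarrow> y) H"
      by (simp add: filterlim_iff_le_filtercomap H_def)
    ultimately show ?thesis
      using cluster[of H y] G(1) unfolding H_def by (metis inf.cobounded1 order_trans)
  qed
  obtain l where "P l" using subfilter[of F] \<open>F \<noteq> bot\<close> by auto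
  have "(f \<longlongrightarrow> l) F"
  proof (rule topological_tendstoI, rule ccontr)
    fix V assume V: "open V" "l \<in> V" and not: "\<not> (\<forall>\<^sub>F x in F. f x \<in> V)"
    define G where "G = inf F (principal {x. f x \<notin> V})"
    have "G \<noteq> bot"
      using not by (auto simp: G_def trivial_limit_def eventually_inf_principal)
    then obtain y H where H: "H \<le> G" "H \<noteq> bot" "(f \<longlongrightarrow> y) H" "P y"
      using subfilter[of G] by (auto simp: G_def)
    have "y = l" using unique H(4) \<open>P l\<close> by blast
    then have "\<forall>\<^sub>F x in H. f x \<in> V"
      using H(3) V by (auto simp: tendsto_def)
    moreover have "\<forall>\<^sub>F x in G. f x \<notin> V"
      by (simp add: G_def eventually_inf_principal)
    then have "\<forall>\<^sub>F x in H. f x \<notin> V"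
      using H(1) by (rule filter_leD[rotated])
    ultimately have "\<forall>\<^sub>F x in H. False"
      by eventually_elim simp
    with H(2) show False by (simp add: trivial_limit_def)
  qed
  then show ?thesis by blast
qed

section \<open>The canonical solution near the real axis\<close>

text \<open>
A product of two points of the upper half plane is never a positive real, whereas \<open>d = 0\<close> would
make \<open>s (z s)\<close> equal to \<open>1 / c\<^sup>2\<close>.
\<close>

lemma denom_nonzero:
  assumes "0 < Im s" and "0 < Im (z * s)"
  shows "denom c z s \<noteq> 0"
proof
  assume "denom c z s = 0"
  then have 1: "(of_real c)\<^sup>2 * (z * s * s) = 1"
    by (simp add: denom_def power2_eq_square mult_ac)
  then have "c \<noteq> 0" by auto
  have "(of_real c)\<^sup>2 * (z * s * (s * cnj s)) = cnj s"
    using 1 by (metis mult.assoc mult.left_neutral)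
  then have "of_real (c\<^sup>2 * (cmod s)\<^sup>2) * (z * s) = cnj s"
    by (simp add: complex_norm_square mult_ac del: of_real_power flip: of_real_power)
  then have "Im (of_real (c\<^sup>2 * (cmod s)\<^sup>2) * (z * s)) = - Im s"
    by simp
  moreover have "Im (of_real p * w) = p * Im w" for p w
    by simp
  ultimately have "c\<^sup>2 * (cmod s)\<^sup>2 * Im (z * s) = - Im s"
    by (simp only:)
  moreover have "0 \<le> c\<^sup>2 * (cmod s)\<^sup>2 * Im (z * s)"
    using assms by simp
  ultimately show False using assms by linarith
qed

text \<open>
Almost every \<open>l\<close> keeps distance \<open>e\<close> from \<open>x\<close>, so the kernel
\<open>Im (1 / (l - z)) = Im z / |l - z|\<^sup>2\<close> is at most \<open>(2 / e)\<^sup>2 Im z\<close> for \<open>z\<close> within \<open>e / 2\<close> of \<open>x\<close>.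
\<close>

lemma stieltjes_Im_le:
  assumes sets: "sets \<mu> = sets borel" and fin: "finite_measure \<mu>"
    and U: "open U" "x \<in> U" "emeasure \<mu> U = 0"
  obtains C e where "0 < C" and "0 < e"
    and "\<And>z. 0 < Im z \<Longrightarrow> cmod (z - of_real x) < e \<Longrightarrow> Im (stieltjes \<mu> z) \<le> C * Im z"
proof -
  interpret finite_measure \<mu> by (rule fin)
  obtain e where e: "0 < e" "ball x e \<subseteq> U"
    using U by (meson open_contains_ball)
  have "U \<in> null_sets \<mu>"
    using U sets by (auto simp: null_sets_def)
  then have AE: "AE l in \<mu>. l \<notin> U"
    by (rule AE_not_in)
  have bound: "Im (stieltjes \<mu> z) \<le> (measure \<mu> (space \<mu>) * (2 / e)\<^sup>2 + 1) * Im z"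
    if z: "0 < Im z" "cmod (z - of_real x) < e / 2" for z
  proof -
    define f where "f l = 1 / (complex_of_real l - z)" for l
    have nz: "complex_of_real l - z \<noteq> 0" for l
      using z by (auto simp: complex_eq_iff)
    have "continuous_on UNIV f"
      unfolding f_def using nz by (intro continuous_intros) auto
    then have "f \<in> borel_measurable \<mu>"
      using borel_measurable_continuous_onI measurable_cong_sets[OF sets refl] by blast
    moreover have "norm (f l) \<le> 1 / Im z" for l
    proof -
      have "Im z \<le> cmod (complex_of_real l - z)"
        using abs_Im_le_cmod[of "complex_of_real l - z"] z by simp
      then show ?thesis using z by (simp add: f_def norm_divide divide_left_mono frac_le)
    qed
    ultimately have int: "integrable \<mu> f"
      by (intro integrable_const_bound[of _ "1 / Im z"]) auto
    have Im_f: "Im (f l) = Im z / (cmod (complex_of_real l - z))\<^sup>2" for l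
      by (simp add: f_def Im_divide cmod_power2)
    have "Im (stieltjes \<mu> z) = (LINT l|\<mu>. Im (f l))"
      unfolding stieltjes_def f_def[symmetric] by (rule integral_Im[OF int, symmetric])
    also have "\<dots> \<le> (LINT l|\<mu>. Im z * (2 / e)\<^sup>2)"
    proof (rule integral_mono_AE)
      show "integrable \<mu> (\<lambda>l. Im (f l))" using int by simp
      show "integrable \<mu> (\<lambda>l. Im z * (2 / e)\<^sup>2)" by simp
      show "AE l in \<mu>. Im (f l) \<le> Im z * (2 / e)\<^sup>2"
        using AE
      proof eventually_elim
        case (elim l)
        then have "l \<notin> ball x e" using e by blast
        then have "e \<le> cmod (complex_of_real x - complex_of_real l)"
          by (metis dist_real_def mem_ball not_le norm_of_real of_real_diff)
        also have "\<dots> \<le> cmod (z - complex_of_real x) + cmod (complex_of_real l - z)"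
          using norm_triangle_ineq[of "complex_of_real x - z" "z - complex_of_real l"]
          by (simp add: norm_minus_commute)
        finally have "e / 2 \<le> cmod (complex_of_real l - z)" using z by linarith
        then have "(e / 2)\<^sup>2 \<le> (cmod (complex_of_real l - z))\<^sup>2"
          using e by (intro power_mono) auto
        then have "Im z / (cmod (complex_of_real l - z))\<^sup>2 \<le> Im z / (e / 2)\<^sup>2"
          using e z nz[of l] by (intro divide_left_mono mult_pos_pos zero_less_power) auto
        then show ?case by (simp add: Im_f power_divide)
      qed
    qed
    also have "\<dots> \<le> (measure \<mu> (space \<mu>) * (2 / e)\<^sup>2 + 1) * Im z"
      using z by (simp add: algebra_simps)
    finally show ?thesis .
  qed
  have "0 < measure \<mu> (space \<mu>) * (2 / e)\<^sup>2 + 1"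
    by (simp add: add_nonneg_pos)
  moreover have "0 < e / 2"
    using e by simp
  ultimately show thesis
    using bound by (rule that)
qed

lemma weights_tendsto:
  assumes "(\<zeta> \<longlongrightarrow> z0) G" "(\<sigma> \<longlongrightarrow> s) G" "(\<Psi> \<longlongrightarrow> \<Theta>) G" and d: "denom c z0 s \<noteq> 0"
  shows "((\<lambda>y. u_weight c R (\<zeta> y) (\<sigma> y) (\<Psi> y)) \<longlongrightarrow> u_weight c R z0 s \<Theta>) G"
    and "((\<lambda>y. v_weight c R (\<zeta> y) (\<sigma> y) (\<Psi> y)) \<longlongrightarrow> v_weight c R z0 s \<Theta>) G"
    and "((\<lambda>y. mean_mass R (\<Psi> y)) \<longlongrightarrow> mean_mass R \<Theta>) G"
proof -
  have d_lim: "((\<lambda>y. denom c (\<zeta> y) (\<sigma> y)) \<longlongrightarrow> denom c z0 s) G"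
    unfolding denom_def by (intro tendsto_intros assms(1-3))
  have W_lim: "((\<lambda>y. mean_energy R (\<Psi> y)) \<longlongrightarrow> mean_energy R \<Theta>) G"
    unfolding mean_energy_def by (intro tendsto_intros assms(1-3)) simp
  have nz: "(cmod (denom c z0 s))\<^sup>2 \<noteq> 0" using d by simp
  show "((\<lambda>y. u_weight c R (\<zeta> y) (\<sigma> y) (\<Psi> y)) \<longlongrightarrow> u_weight c R z0 s \<Theta>) G"
    unfolding u_weight_def by (intro tendsto_intros assms(1-3) d_lim W_lim nz)
  show "((\<lambda>y. v_weight c R (\<zeta> y) (\<sigma> y) (\<Psi> y)) \<longlongrightarrow> v_weight c R z0 s \<Theta>) G"
    unfolding v_weight_def by (intro tendsto_intros assms(1-3) d_lim W_lim nz)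
  show "((\<lambda>y. mean_mass R (\<Psi> y)) \<longlongrightarrow> mean_mass R \<Theta>) G"
    unfolding mean_mass_def by (intro tendsto_intros assms(1-3))
qed

lemma at_within_upper_half_plane_neq_bot: "at (complex_of_real x) within upper_half_plane \<noteq> bot"
proof -
  have "complex_of_real x islimpt upper_half_plane"
    unfolding islimpt_approachable
  proof (intro allI impI)
    fix e :: real assume "0 < e"
    then show "\<exists>y\<in>upper_half_plane. y \<noteq> complex_of_real x \<and> dist y (complex_of_real x) < e"
      by (intro bexI[of _ "Complex x (e / 2)"])
        (auto simp: upper_half_plane_def complex_eq_iff dist_norm cmod_def)
  qed
  then show ?thesis by (simp add: trivial_limit_within)
qed

lemma eventually_upper_half_plane: "\<forall>\<^sub>F z in at x within upper_half_plane. z \<in> upper_half_plane"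
  by (simp add: eventually_at_filter)

context positive_matrix
begin

text \<open>
The coefficient \<open>\<gamma>\<close> of \<open>R\<close> in \<open>A = z + \<gamma> R\<close> has positive imaginary part. Hence the quadratic form
of \<open>A\<close> has positive imaginary part at nonzero vectors, \<open>A\<close> is injective, and the matrix inverses in
the definitions are genuine.
\<close>

lemma canonical_solution_resolvent_pair:
  assumes z: "0 < Im z" and sol: "canonical_solution c R z s"
  shows "resolvent_pair c R z s (T_matrix c R z s)"
    and "u_weight c R z s (T_matrix c R z s) + cmod z * v_weight c R z s (T_matrix c R z s) < 1"
proof -
  have s: "0 < Im s" "0 < Im (z * s)"
    using sol by (simp_all add: canonical_solution_def upper_half_plane_def)
  have d: "denom c z s \<noteq> 0" by (rule denom_nonzero[OF s])
  define \<gamma> where "\<gamma> = z * (of_real c * s / denom c z s)"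
  have \<gamma>: "z * of_real c * s / (1 - z * (of_real c)\<^sup>2 * s\<^sup>2) = \<gamma>"
    by (simp add: \<gamma>_def denom_def mult_ac)
  define A where "A = mat z + mat \<gamma> ** R"
  have "0 < c * Im (z * s) + c^3 * (cmod (z * s))\<^sup>2 * Im s"
    using s c_pos by (simp add: add_pos_nonneg)
  then have "0 < Im \<gamma>"
    using d by (simp only: \<gamma>_def times_divide_eq_right Im_coupling(1)) simp
  \<comment> \<open>Both summands of the imaginary part of \<open>x\<^sup>* A x\<close> are nonnegative, and the first is positive unless \<open>x = 0\<close>.\<close>
  have ker: "x = 0" if "A *v x = 0" for x
  proof (rule ccontr)
    assume "x \<noteq> 0"
    then have x: "0 < (norm x)\<^sup>2" by simp
    then have R: "0 \<le> Re (quad_form R x)"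
      using quad_form_ge[of x] a_pos by (smt (verit) mult_nonneg_nonneg)
    have "quad_form A x = 0"
      using that by (simp add: quad_form_def)
    then have "Im (z * of_real ((norm x)\<^sup>2) + \<gamma> * quad_form R x) = 0"
      by (simp add: A_def quad_form_add quad_form_mat quad_form_mat_mult del: of_real_power)
    then have "Im z * (norm x)\<^sup>2 + Im \<gamma> * Re (quad_form R x) = 0"
      by (simp add: quad_form_real del: of_real_power)
    moreover have "0 < Im z * (norm x)\<^sup>2 + Im \<gamma> * Re (quad_form R x)"
      using z x R \<open>0 < Im \<gamma>\<close> by (intro add_pos_nonneg) auto
    ultimately show False by simp
  qed
  then obtain B where "B ** A = mat 1"
    using matrix_left_invertible_ker by blast
  then have AB: "A ** B = mat 1" by (simp add: matrix_left_right_inverse)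
  have T: "T_matrix c R z s = - B"
    unfolding T_matrix_def \<gamma> A_def[symmetric] by (simp add: matrix_inv_eqI[OF AB])
  have "s = ntrace (R ** matrix_inv (- mat z - mat \<gamma> ** R))"
    using sol unfolding canonical_solution_def \<gamma> by blast
  also have "- mat z - mat \<gamma> ** R = - A"
    by (simp add: A_def)
  also have "matrix_inv (- A) = - B"
    by (rule matrix_inv_eqI) (simp add: matrix_mult_minus_left matrix_mult_minus_right AB)
  finally have "s = ntrace (R ** T_matrix c R z s)"
    unfolding T .
  moreover have "A ** T_matrix c R z s = - mat 1"
    by (simp add: T matrix_mult_minus_right AB)
  ultimately show pair: "resolvent_pair c R z s (T_matrix c R z s)"
    using d unfolding resolvent_pair_def A_def \<gamma>_def by blast
  show "u_weight c R z s (T_matrix c R z s) + cmod z * v_weight c R z s (T_matrix c R z s) < 1"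
    by (rule weights_upper_half_plane[OF pair z s])
qed

text \<open>
The pair \<open>(t, T)\<close> is treated as one function, because the uniqueness of limit points concerns the
pair.
\<close>

lemma boundary_limits_exist:
  fixes t :: "complex \<Rightarrow> complex" and T :: "complex \<Rightarrow> complex^'m^'m" and x :: real
  assumes pair: "\<And>z. z \<in> upper_half_plane \<Longrightarrow> resolvent_pair c R z (t z) (T z)"
    and weights: "\<And>z. z \<in> upper_half_plane \<Longrightarrow>
      u_weight c R z (t z) (T z) + cmod z * v_weight c R z (t z) (T z) \<le> 1"
    and Im_t: "\<And>z. z \<in> upper_half_plane \<Longrightarrow> 0 \<le> Im (t z)"
    and "0 < x"
  obtains s \<Theta> where "(t \<longlongrightarrow> s) (at (of_real x) within upper_half_plane)"
    and "(T \<longlongrightarrow> \<Theta>) (at (of_real x) within upper_half_plane)"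
proof -
  let ?F = "at (complex_of_real x) within upper_half_plane"
  define P where "P y \<longleftrightarrow> resolvent_pair c R (of_real x) (fst y) (snd y) \<and> 0 \<le> Im (fst y) \<and>
      u_weight c R (of_real x) (fst y) (snd y) + x * v_weight c R (of_real x) (fst y) (snd y) \<le> 1"
    for y :: "complex \<times> (complex^'m^'m)"
  have "0 < x / 2" using \<open>0 < x\<close> by simp
  then obtain K where K: "\<And>z s \<Theta>. resolvent_pair c R z s \<Theta> \<Longrightarrow> x / 2 \<le> cmod z \<Longrightarrow> cmod z \<le> 2 * x \<Longrightarrow>
     u_weight c R z s \<Theta> + cmod z * v_weight c R z s \<Theta> \<le> 1 \<Longrightarrow> norm (s, \<Theta>) \<le> K"
    using resolvent_pair_bounded[of "x / 2" "2 * x"] by blast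
  have ident: "((\<lambda>z. z) \<longlongrightarrow> complex_of_real x) ?F" by (rule tendsto_ident_at)
  have norm_lim: "(cmod \<longlongrightarrow> x) ?F"
    using tendsto_norm[OF ident] \<open>0 < x\<close> by simp
  have "\<forall>\<^sub>F z in ?F. x / 2 < cmod z"
    by (rule order_tendstoD(1)[OF norm_lim]) (use \<open>0 < x\<close> in simp)
  moreover have "\<forall>\<^sub>F z in ?F. cmod z < 2 * x"
    by (rule order_tendstoD(2)[OF norm_lim]) (use \<open>0 < x\<close> in simp)
  ultimately have bounded: "\<forall>\<^sub>F z in ?F. (t z, T z) \<in> cball 0 K"
    using eventually_upper_half_plane
    by eventually_elim (use K[OF pair _ _ weights] in auto)
  have cluster: "P y" if G: "G \<le> ?F" "G \<noteq> bot" and lim: "((\<lambda>z. (t z, T z)) \<longlongrightarrow> y) G" for G y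
  proof -
    have lim': "(t \<longlongrightarrow> fst y) G" "(T \<longlongrightarrow> snd y) G"
      using tendsto_fst[OF lim] tendsto_snd[OF lim] by simp_all
    have id: "((\<lambda>z. z) \<longlongrightarrow> complex_of_real x) G"
      by (rule tendsto_mono[OF G(1) ident])
    have up: "\<forall>\<^sub>F z in G. z \<in> upper_half_plane"
      by (rule filter_leD[OF G(1) eventually_upper_half_plane])
    have ev: "\<forall>\<^sub>F z in G. resolvent_pair c R z (t z) (T z) \<and>
        u_weight c R z (t z) (T z) + cmod z * v_weight c R z (t z) (T z) \<le> 1"
      using up by eventually_elim (use pair weights in blast)
    have "complex_of_real x \<noteq> 0" using \<open>0 < x\<close> by simp
    note boundary = resolvent_pair_tendsto[OF G(2) this c_pos id lim' ev]
    have "0 \<le> Im (fst y)"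
    proof (rule tendsto_lowerbound[OF tendsto_Im[OF lim'(1)] _ G(2)])
      show "\<forall>\<^sub>F z in G. 0 \<le> Im (t z)"
        using up by eventually_elim (rule Im_t)
    qed
    then show "P y" using boundary \<open>0 < x\<close> by (simp add: P_def)
  qed
  have unique: "y = y'" if "P y" "P y'" for y y'
    using boundary_pair_unique[OF \<open>0 < x\<close>] that unfolding P_def by (meson prod_eqI)
  have "\<exists>l. ((\<lambda>z. (t z, T z)) \<longlongrightarrow> l) ?F"
    by (rule tendsto_if_unique_cluster_point[where P = P, OF at_within_upper_half_plane_neq_bot compact_cball bounded])
      (fact cluster unique)+
  then obtain l where "((\<lambda>z. (t z, T z)) \<longlongrightarrow> l) ?F" ..
  from that tendsto_fst[OF this] tendsto_snd[OF this] show thesis by simp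
qed

lemma resolvent_pair_real_point:
  assumes pair: "resolvent_pair c R (of_real x) s \<Theta>" and "x \<noteq> 0"
  shows "1 - of_real x * (of_real c * s)\<^sup>2 \<noteq> 0"
    and "invertible (mat 1 + mat (of_real c * s / (1 - of_real x * (of_real c * s)\<^sup>2)) ** R)"
    and "\<Theta> = matrix_inv (mat (- of_real x) **
           (mat 1 + mat (of_real c * s / (1 - of_real x * (of_real c * s)\<^sup>2)) ** R))"
proof -
  have d: "1 - of_real x * (of_real c * s)\<^sup>2 = denom c (of_real x) s"
    by (simp add: denom_def power_mult_distrib)
  show "1 - of_real x * (of_real c * s)\<^sup>2 \<noteq> 0"
    unfolding d by (rule resolvent_pairD(1)[OF pair])
  define \<beta> where "\<beta> = of_real c * s / denom c (of_real x) s"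
  define B where "B = mat 1 + mat \<beta> ** R"
  have "mat (- of_real x) ** B = - (mat (of_real x) + mat (of_real x * \<beta>) ** R)"
    by (simp add: B_def vec_eq_iff mat_mult_nth algebra_simps) (simp add: mat_def)
  then have 1: "(mat (- of_real x) ** B) ** \<Theta> = mat 1"
    by (simp only: matrix_mult_minus_left resolvent_pairD(2)[OF pair, folded \<beta>_def]) simp
  then show "\<Theta> = matrix_inv (mat (- of_real x) **
           (mat 1 + mat (of_real c * s / (1 - of_real x * (of_real c * s)\<^sup>2)) ** R))"
    unfolding d \<beta>_def[symmetric] B_def[symmetric] by (rule matrix_inv_eqI[symmetric])
  have "B ** (mat (- of_real x) ** \<Theta>) = mat 1"
    using 1 by (metis mult_mat_eq_mat_mult matrix_mul_assoc)
  then show "invertible (mat 1 + mat (of_real c * s / (1 - of_real x * (of_real c * s)\<^sup>2)) ** R)"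
    unfolding d \<beta>_def[symmetric] B_def[symmetric] invertible_right_inverse by blast
qed

text \<open>
In the upper half plane the discriminant identity and \<open>Im t \<le> C Im z\<close> give
\<open>(1 - u) q \<le> C ((1 - u)\<^sup>2 - |z|\<^sup>2 v\<^sup>2)\<close>, where \<open>Im z\<close> has cancelled. This survives the limit, where the
left-hand side is still positive.
\<close>

lemma discriminant_pos_off_support:
  fixes x C :: real
  assumes pair: "\<And>z. z \<in> upper_half_plane \<Longrightarrow> resolvent_pair c R z (t z) (T z)"
    and weights: "\<And>z. z \<in> upper_half_plane \<Longrightarrow>
      u_weight c R z (t z) (T z) + cmod z * v_weight c R z (t z) (T z) < 1"
    and lim: "(t \<longlongrightarrow> s) (at (of_real x) within upper_half_plane)"
      "(T \<longlongrightarrow> \<Theta>) (at (of_real x) within upper_half_plane)"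
    and pair0: "resolvent_pair c R (of_real x) s \<Theta>"
    and u: "u_weight c R (of_real x) s \<Theta> < 1"
    and "0 < C"
    and Im_t: "\<forall>\<^sub>F z in at (of_real x) within upper_half_plane. Im (t z) \<le> C * Im z"
  shows "0 < (1 - u_weight c R (of_real x) s \<Theta>)\<^sup>2 - x\<^sup>2 * (v_weight c R (of_real x) s \<Theta>)\<^sup>2"
proof -
  let ?F = "at (complex_of_real x) within upper_half_plane"
  let ?u = "\<lambda>z. u_weight c R z (t z) (T z)" and ?v = "\<lambda>z. v_weight c R z (t z) (T z)"
  note conv = weights_tendsto[OF tendsto_ident_at lim resolvent_pairD(1)[OF pair0]]
  have "(1 - u_weight c R (of_real x) s \<Theta>) * mean_mass R \<Theta> \<le>
      C * ((1 - u_weight c R (of_real x) s \<Theta>)\<^sup>2 - (cmod (of_real x))\<^sup>2 * (v_weight c R (of_real x) s \<Theta>)\<^sup>2)"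
  proof (rule tendsto_le[OF at_within_upper_half_plane_neq_bot])
    show "((\<lambda>z. (1 - ?u z) * mean_mass R (T z)) \<longlongrightarrow> (1 - u_weight c R (of_real x) s \<Theta>) * mean_mass R \<Theta>) ?F"
      by (intro tendsto_intros conv)
    show "((\<lambda>z. C * ((1 - ?u z)\<^sup>2 - (cmod z)\<^sup>2 * (?v z)\<^sup>2)) \<longlongrightarrow>
      C * ((1 - u_weight c R (of_real x) s \<Theta>)\<^sup>2 - (cmod (of_real x))\<^sup>2 * (v_weight c R (of_real x) s \<Theta>)\<^sup>2)) ?F"
      by (intro tendsto_intros conv)
    show "\<forall>\<^sub>F z in ?F. (1 - ?u z) * mean_mass R (T z) \<le> C * ((1 - ?u z)\<^sup>2 - (cmod z)\<^sup>2 * (?v z)\<^sup>2)"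
      using eventually_upper_half_plane Im_t
    proof eventually_elim
      case (elim z)
      note pz = pair[OF elim(1)]
      have "0 \<le> cmod z * ?v z"
        using resolvent_pair_pos(3)[OF pz] by simp
      then have "(cmod z * ?v z)\<^sup>2 \<le> (1 - ?u z)\<^sup>2"
        using weights[OF elim(1)] by (intro power_mono) auto
      then have D: "0 \<le> (1 - ?u z)\<^sup>2 - (cmod z)\<^sup>2 * (?v z)\<^sup>2"
        by (simp add: power_mult_distrib)
      have "(1 - ?u z) * mean_mass R (T z) * Im z = ((1 - ?u z)\<^sup>2 - (cmod z)\<^sup>2 * (?v z)\<^sup>2) * Im (t z)"
        unfolding discriminant_identity[OF pz] by simp
      also have "\<dots> \<le> ((1 - ?u z)\<^sup>2 - (cmod z)\<^sup>2 * (?v z)\<^sup>2) * (C * Im z)"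
        by (rule mult_left_mono[OF elim(2) D])
      finally have "(1 - ?u z) * mean_mass R (T z) * Im z \<le> C * ((1 - ?u z)\<^sup>2 - (cmod z)\<^sup>2 * (?v z)\<^sup>2) * Im z"
        by (simp only: mult_ac)
      moreover have "0 < Im z" using elim(1) by (simp add: upper_half_plane_def)
      ultimately show ?case by (rule mult_right_le_imp_le)
    qed
  qed
  moreover have "0 < (1 - u_weight c R (of_real x) s \<Theta>) * mean_mass R \<Theta>"
    using u resolvent_pair_pos(1)[OF pair0] by simp
  ultimately have "0 < C * ((1 - u_weight c R (of_real x) s \<Theta>)\<^sup>2 - (cmod (of_real x))\<^sup>2 * (v_weight c R (of_real x) s \<Theta>)\<^sup>2)"
    by linarith
  then have "0 < (1 - u_weight c R (of_real x) s \<Theta>)\<^sup>2 - (cmod (of_real x))\<^sup>2 * (v_weight c R (of_real x) s \<Theta>)\<^sup>2"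
    using \<open>0 < C\<close> by (simp only: zero_less_mult_pos)
  then show ?thesis by simp
qed

end

section \<open>Boundary values of the canonical solution\<close>

theorem proposition7:
  fixes R :: "complex^'m^'m"
    and N L :: nat
    and a b c :: real
    and \<mu> :: "real measure"
    and S :: "real set"
    and t :: "complex \<Rightarrow> complex"
    and T :: "complex \<Rightarrow> complex^'m^'m"
    and tx :: "real \<Rightarrow> complex"
    and Tx :: "real \<Rightarrow> complex^'m^'m"
    and u v :: "real \<Rightarrow> real"
  assumes "N \<ge> 1" and "L \<ge> 1"
    and "c = real CARD('m) * real L / real N"
    and "hermitian R" and "0 < a" and "a < b"
    and "pos_semidef (R - mat (of_real a))"
    and "pos_def (mat (of_real b) - R)"
    and "\<And>z. z \<in> upper_half_plane \<Longrightarrow>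
           canonical_solution c R z (t z) \<and> (\<forall>s. canonical_solution c R z s \<longrightarrow> s = t z)"
    and "\<And>z. z \<in> upper_half_plane \<Longrightarrow> T z = T_matrix c R z (t z)"
    and "sets \<mu> = sets borel" and "finite_measure \<mu>" and "emeasure \<mu> {..<0} = 0"
    and "\<And>z. z \<in> upper_half_plane \<Longrightarrow> t z = stieltjes \<mu> z"
    and "S = measure_support \<mu>"
    and "t analytic_on - (complex_of_real ` S)"
    and "\<And>i j. (\<lambda>z. T z $ i $ j) analytic_on - (complex_of_real ` S)"
    and "tx = real_axis_value t"
    and "Tx = real_axis_value T"
    and "\<And>x. u x = u_coeff c R x (tx x) (Tx x)"
    and "\<And>x. v x = v_coeff c R x (tx x) (Tx x)"
  shows "(\<forall>x>0.
            (t \<longlongrightarrow> tx x) (at (complex_of_real x) within upper_half_plane)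
          \<and> 1 - of_real x * (of_real c * tx x)\<^sup>2 \<noteq> 0
          \<and> invertible (mat 1 + mat (of_real c * tx x / (1 - of_real x * (of_real c * tx x)\<^sup>2)) ** R)
          \<and> (T \<longlongrightarrow> Tx x) (at (complex_of_real x) within upper_half_plane)
          \<and> Tx x = matrix_inv (mat (- of_real x) **
                (mat 1 + mat (of_real c * tx x / (1 - of_real x * (of_real c * tx x)\<^sup>2)) ** R))
          \<and> tx x = ntrace (R ** Tx x))
       \<and> (\<forall>x. x \<noteq> 0 \<longrightarrow> 1 - u x > 0 \<and> (1 - u x)\<^sup>2 - x\<^sup>2 * (v x)\<^sup>2 \<ge> 0)
       \<and> (\<forall>x\<in>{0..} - S. (1 - u x)\<^sup>2 - x\<^sup>2 * (v x)\<^sup>2 > 0)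
       \<and> (\<forall>x. x \<noteq> 0 \<longrightarrow> Im (tx x) > 0 \<longrightarrow> 1 - u x - x * v x = 0)"
proof -
  let ?F = "\<lambda>x. at (complex_of_real x) within upper_half_plane"
  have "0 < c"
    using assms(1-3) by simp
  interpret positive_matrix R a c
    by unfold_locales (fact assms(4) assms(7) assms(5) \<open>0 < c\<close>)+
  have sol: "canonical_solution c R z (t z)" and T: "T z = T_matrix c R z (t z)"
    if "z \<in> upper_half_plane" for z
    using assms(9,10)[OF that] by simp_all
  have pair: "resolvent_pair c R z (t z) (T z)"
    and weights: "u_weight c R z (t z) (T z) + cmod z * v_weight c R z (t z) (T z) < 1"
    and Im_t: "0 < Im (t z)"
    if z: "z \<in> upper_half_plane" for z
    using canonical_solution_resolvent_pair[OF _ sol[OF z]] z sol[OF z] unfolding T[OF z]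
    by (simp_all add: upper_half_plane_def canonical_solution_def)

  \<comment> \<open>For \<open>x > 0\<close> the values \<open>tx x\<close>, \<open>Tx x\<close> are defined as limits, which must be shown to exist; for \<open>x < 0\<close>
  they are values of the analytic continuation across the negative axis, which avoids the support.\<close>
  have limits: "(t \<longlongrightarrow> tx x) (?F x) \<and> (T \<longlongrightarrow> Tx x) (?F x)" if "x \<noteq> 0" for x
  proof (cases "0 < x")
    case True
    obtain s \<Theta> where lim: "(t \<longlongrightarrow> s) (?F x)" "(T \<longlongrightarrow> \<Theta>) (?F x)"
      using boundary_limits_exist[OF pair less_imp_le[OF weights] less_imp_le[OF Im_t] True] by blast
    then have "tx x = s" "Tx x = \<Theta>"
      using True tendsto_Lim[OF at_within_upper_half_plane_neq_bot]
      by (simp_all add: \<open>tx = real_axis_value t\<close> \<open>Tx = real_axis_value T\<close> real_axis_value_def)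
    with lim show ?thesis by simp
  next
    case False
    with that have "x < 0" by simp
    then have "x \<notin> S"
      using \<open>emeasure \<mu> {..<0} = 0\<close> unfolding \<open>S = measure_support \<mu>\<close> measure_support_def
      by (auto intro!: exI[of _ "{..<0}"])
    then have x: "{complex_of_real x} \<subseteq> - (complex_of_real ` S)" by auto
    have "isCont t (of_real x)" "isCont (\<lambda>z. T z $ i $ j) (of_real x)" for i j
      using analytic_on_subset[OF _ x] assms(16,17) analytic_at_imp_isCont by blast+
    then have "(t \<longlongrightarrow> t (of_real x)) (?F x)"
      "((\<lambda>z. T z $ i $ j) \<longlongrightarrow> T (of_real x) $ i $ j) (?F x)" for i j
      unfolding isCont_def by (auto intro: tendsto_within_subset)
    then have "(t \<longlongrightarrow> t (of_real x)) (?F x)" "(T \<longlongrightarrow> T (of_real x)) (?F x)"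
      by (auto intro!: vec_tendstoI)
    then show ?thesis
      using False by (simp add: \<open>tx = real_axis_value t\<close> \<open>Tx = real_axis_value T\<close> real_axis_value_def)
  qed

  have boundary: "resolvent_pair c R (of_real x) (tx x) (Tx x)"
      "u x + \<bar>x\<bar> * v x \<le> 1" if "x \<noteq> 0" for x
  proof -
    have "\<forall>\<^sub>F z in ?F x. resolvent_pair c R z (t z) (T z) \<and>
        u_weight c R z (t z) (T z) + cmod z * v_weight c R z (t z) (T z) \<le> 1"
      using eventually_upper_half_plane
      by eventually_elim (use pair weights less_imp_le in blast)
    from resolvent_pair_tendsto[OF at_within_upper_half_plane_neq_bot _ c_pos tendsto_ident_at
        conjunct1[OF limits[OF that]] conjunct2[OF limits[OF that]] this]
    show "resolvent_pair c R (of_real x) (tx x) (Tx x)" "u x + \<bar>x\<bar> * v x \<le> 1"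
      using that by (simp_all add: assms(20,21) u_coeff_eq_u_weight[OF hermitian] v_coeff_eq_v_weight[OF hermitian])
  qed
  have uv: "u x = u_weight c R (of_real x) (tx x) (Tx x)" "v x = v_weight c R (of_real x) (tx x) (Tx x)" for x
    by (simp_all add: assms(20,21) u_coeff_eq_u_weight[OF hermitian] v_coeff_eq_v_weight[OF hermitian])
  have v_pos: "0 < v x" if "x \<noteq> 0" for x
    unfolding uv by (rule resolvent_pair_pos(3)[OF boundary(1)[OF that]])
  have u_less: "u x < 1" if "x \<noteq> 0" for x
    using boundary(2)[OF that] mult_pos_pos[OF _ v_pos[OF that], of "\<bar>x\<bar>"] that by simp

  have part1: "(t \<longlongrightarrow> tx x) (?F x)
      \<and> 1 - of_real x * (of_real c * tx x)\<^sup>2 \<noteq> 0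
      \<and> invertible (mat 1 + mat (of_real c * tx x / (1 - of_real x * (of_real c * tx x)\<^sup>2)) ** R)
      \<and> (T \<longlongrightarrow> Tx x) (?F x)
      \<and> Tx x = matrix_inv (mat (- of_real x) **
            (mat 1 + mat (of_real c * tx x / (1 - of_real x * (of_real c * tx x)\<^sup>2)) ** R))
      \<and> tx x = ntrace (R ** Tx x)" if "0 < x" for x
  proof -
    have "x \<noteq> 0" using that by simp
    note p = boundary(1)[OF this]
    show ?thesis
      using limits[OF \<open>x \<noteq> 0\<close>] resolvent_pair_real_point[OF p \<open>x \<noteq> 0\<close>] resolvent_pairD(3)[OF p]
      by blast
  qed

  have part2: "1 - u x > 0 \<and> (1 - u x)\<^sup>2 - x\<^sup>2 * (v x)\<^sup>2 \<ge> 0" if "x \<noteq> 0" for x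
  proof -
    have "(\<bar>x\<bar> * v x)\<^sup>2 \<le> (1 - u x)\<^sup>2"
      using boundary(2)[OF that] v_pos[OF that] by (intro power_mono) auto
    then show ?thesis
      using u_less[OF that] by (simp add: power_mult_distrib)
  qed

  have part3: "(1 - u x)\<^sup>2 - x\<^sup>2 * (v x)\<^sup>2 > 0" if x: "x \<in> {0..} - S" for x
  proof (cases "x = 0")
    case True
    then show ?thesis by (simp add: uv u_weight_def)
  next
    case False
    obtain U where U: "open U" "x \<in> U" "emeasure \<mu> U = 0"
      using x unfolding \<open>S = measure_support \<mu>\<close> measure_support_def by auto
    obtain C e where C: "0 < C" "0 < e"
      and le: "\<And>z. 0 < Im z \<Longrightarrow> cmod (z - of_real x) < e \<Longrightarrow> Im (stieltjes \<mu> z) \<le> C * Im z"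
      using stieltjes_Im_le[OF assms(11,12) U] by blast
    have "\<forall>\<^sub>F z in ?F x. Im (t z) \<le> C * Im z"
      unfolding eventually_at using C(2) le assms(14)
      by (intro exI[of _ e]) (simp add: dist_norm upper_half_plane_def)
    then show ?thesis
      using discriminant_pos_off_support[OF pair weights _ _ boundary(1)[OF False] _ C(1)]
        limits[OF False] u_less[OF False] unfolding uv by blast
  qed

  have part4: "1 - u x - x * v x = 0" if "x \<noteq> 0" and Im: "Im (tx x) > 0" for x
  proof -
    have "(1 - u x) * Im (tx x) - v x * Im (of_real x * tx x) = 0"
      using imaginary_part_system(1)[OF boundary(1)[OF that(1)]] by (simp add: uv)
    then have "(1 - u x - x * v x) * Im (tx x) = 0"
      by (simp add: algebra_simps)
    with Im show ?thesis by simp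
  qed

  from part1 part2 part3 part4 show ?thesis by blast
qed

end
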